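(* Let $\{Z_n\}_{n\ge 0}$ be a branching random walk on $\mathbb{R}$ with offspring law $\{p_k\}_{k\ge0}$ satisfying $p_0=0$ and $1<m<\infty$, and with step size $X$ a standard normal random variable. Assume $\mathbb{P}(|Z_1|>y)=\Theta(1)y^{-\beta}$ for some $\beta>1$. Let $x>0$ and $a\in\left(\left(\log m-\frac{x^2}{2}\right)^+,\infty\right)$. Then $$-\left[(\beta-1)a+a-\left(\log m-\frac{x^2}{2}\right)\right]\leq\liminf_{n\rightarrow\infty}\frac{1}{n}\log\mathbb{P}(Z_n([xn,\infty))\geq e^{an})\leq\limsup_{n\rightarrow\infty}\frac{1}{n}\log\mathbb{P}(Z_n([xn,\infty))\geq e^{an})\leq-\left[a-\left(\log m-\frac{x^2}{2}\right)\right].$$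
   Context: Branching random walk: at time $0$ there is one particle at the origin ($Z_0=\delta_0$). At each time step every particle dies and produces a random number of offspring according to $\{p_k\}_{k\ge0}$, after which each offspring moves from its parent's position by an independent displacement distributed as $X$; the branching and the motion are independent, and different particles behave independently. $Z_n$ is the point process (counting measure) of positions of the particles at generation $n$; $Z_n(A)$ is the number of generation-$n$ particles located in $A\subset\mathbb{R}$; $|Z_n|:=Z_n(\mathbb{R})$; $m:=\mathbb{E}[|Z_1|]=\sum_k kp_k$. Notation: $f(y)=\Theta(1)g(y)$ means $0<\liminf_{y\to+\infty}f(y)/g(y)\le\limsup_{y\to+\infty}f(y)/g(y)<\infty$; $r^+:=\max\{r,0\}$. *)

theory Defs
  imports "HOL-Probability.Probability"
begin

text \<open>
  Particles carry Ulam--Harris labels, written with the most recent generation first: the ancestor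
  is \<^term>\<open>[]\<close> and the children of \<open>u\<close> are \<open>i # u\<close> for \<open>i < N u \<omega>\<close>, where \<open>N u\<close> is the offspring
  number of \<open>u\<close>. \<open>X u\<close> is the displacement of \<open>u\<close> from its parent; since the ancestor starts
  at the origin, \<open>X []\<close> is never used.
\<close>

primrec particles :: "(nat list \<Rightarrow> 'w \<Rightarrow> nat) \<Rightarrow> nat \<Rightarrow> 'w \<Rightarrow> nat list set" where
  "particles N 0 \<omega> = {[]}"
| "particles N (Suc n) \<omega> = {i # u | i u. u \<in> particles N n \<omega> \<and> i < N u \<omega>}"

primrec position :: "(nat list \<Rightarrow> 'w \<Rightarrow> real) \<Rightarrow> nat list \<Rightarrow> 'w \<Rightarrow> real" where
  "position X [] \<omega> = 0"
| "position X (i # u) \<omega> = position X u \<omega> + X (i # u) \<omega>"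

definition Z :: "(nat list \<Rightarrow> 'w \<Rightarrow> nat) \<Rightarrow> (nat list \<Rightarrow> 'w \<Rightarrow> real) \<Rightarrow> nat \<Rightarrow> 'w \<Rightarrow> real set \<Rightarrow> nat" where
  "Z N X n \<omega> A = card {u \<in> particles N n \<omega>. position X u \<omega> \<in> A}"

text \<open>
  Independence of the pairs over all labels, together with independence of \<open>N u\<close> and \<open>X u\<close> inside
  each pair, makes all offspring numbers and displacements mutually independent.
\<close>

locale branching_random_walk = prob_space M for M :: "'w measure" +
  fixes p :: "nat pmf" \<comment> \<open>offspring law\<close>
    and D :: "real measure" \<comment> \<open>law of the step size\<close>
    and N :: "nat list \<Rightarrow> 'w \<Rightarrow> nat"
    and X :: "nat list \<Rightarrow> 'w \<Rightarrow> real"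
  assumes indep_particles:
      "indep_vars (\<lambda>_. count_space UNIV \<Otimes>\<^sub>M borel) (\<lambda>u \<omega>. (N u \<omega>, X u \<omega>)) UNIV"
    and indep_branching_motion: "indep_var borel (\<lambda>\<omega>. real (N u \<omega>)) borel (X u)"
    and offspring_law: "distr M (count_space UNIV) (N u) = measure_pmf p"
    and step_law: "distr M borel (X u) = D"

definition mean_offspring ::
    "'w measure \<Rightarrow> (nat list \<Rightarrow> 'w \<Rightarrow> nat) \<Rightarrow> (nat list \<Rightarrow> 'w \<Rightarrow> real) \<Rightarrow> real" where
  "mean_offspring M N X = (\<integral>\<omega>. real (Z N X 1 \<omega> UNIV) \<partial>M)"

definition same_order :: "(real \<Rightarrow> real) \<Rightarrow> (real \<Rightarrow> real) \<Rightarrow> bool" where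
  "same_order f g \<longleftrightarrow>
     0 < Liminf at_top (\<lambda>y. ereal (f y / g y)) \<and> Limsup at_top (\<lambda>y. ereal (f y / g y)) < \<infinity>"

text \<open>The logarithm of a probability; \<^const>\<open>ln\<close> would give \<open>ln 0 = 0\<close> instead of \<open>-\<infinity>\<close>.\<close>

definition elog :: "real \<Rightarrow> ereal" where
  "elog r = (if r \<le> 0 then -\<infinity> else ereal (ln r))"

lemma finite_particles: "finite (particles N n \<omega>)"
proof (induction n)
  case (Suc n)
  have "particles N (Suc n) \<omega> = (\<Union>u\<in>particles N n \<omega>. (\<lambda>i. i # u) ` {..<N u \<omega>})"
    by auto
  then show ?case using Suc by simp
qed simp

lemma Z_0: "Z N X 0 \<omega> A = (if 0 \<in> A then 1 else 0)"
proof -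
  have "{u \<in> particles N 0 \<omega>. position X u \<omega> \<in> A} = (if 0 \<in> A then {[]} else {})" by auto
  then show ?thesis by (simp add: Z_def)
qed

lemma Z_1_UNIV: "Z N X 1 \<omega> UNIV = N [] \<omega>"
proof -
  have "{u \<in> particles N 1 \<omega>. position X u \<omega> \<in> UNIV} = (\<lambda>i. [i]) ` {..<N [] \<omega>}" by auto
  then show ?thesis by (simp add: Z_def card_image inj_on_def)
qed

context branching_random_walk
begin

lemma measurable_N [measurable]: "N u \<in> measurable M (count_space UNIV)"
proof -
  have "(\<lambda>\<omega>. (N u \<omega>, X u \<omega>)) \<in> measurable M (count_space UNIV \<Otimes>\<^sub>M borel)"
    using indep_particles unfolding indep_vars_def by auto
  from measurable_compose[OF this measurable_fst] show ?thesis by simp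
qed

lemma measurable_X [measurable]: "X u \<in> borel_measurable M"
  using indep_branching_motion[of u] by (rule indep_var_rv2)

lemma measurable_position [measurable]: "position X u \<in> borel_measurable M"
proof (induction u)
  case Nil
  have "position X [] = (\<lambda>_. 0)" by auto
  then show ?case by simp
next
  case (Cons i u)
  have "position X (i # u) = (\<lambda>\<omega>. position X u \<omega> + X (i # u) \<omega>)" by auto
  then show ?case using Cons by simp
qed

lemma measurable_particles [measurable]: "Measurable.pred M (\<lambda>\<omega>. u \<in> particles N n \<omega>)"
proof (induction n arbitrary: u)
  case (Suc n)
  show ?case
  proof (cases u)
    case (Cons i v)
    have [measurable]: "Measurable.pred M (\<lambda>\<omega>. v \<in> particles N n \<omega>)" by (rule Suc)
    have "Measurable.pred M (\<lambda>\<omega>. v \<in> particles N n \<omega> \<and> i < N v \<omega>)" by measurable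
    then show ?thesis by (simp add: Cons)
  qed simp
qed simp

lemma sets_Z_ge:
  assumes [measurable]: "A \<in> sets borel"
  shows "{\<omega> \<in> space M. real (Z N X n \<omega> A) \<ge> c} \<in> sets M"
proof -
  let ?F = "{F :: nat list set. finite F \<and> c \<le> real (card F)}"
  let ?E = "\<lambda>F. {\<omega> \<in> space M. \<forall>u\<in>F. u \<in> particles N n \<omega> \<and> position X u \<omega> \<in> A}"
  have "{\<omega> \<in> space M. real (Z N X n \<omega> A) \<ge> c} = (\<Union>F\<in>?F. ?E F)"
  proof (intro equalityI subsetI)
    fix \<omega> assume "\<omega> \<in> {\<omega> \<in> space M. real (Z N X n \<omega> A) \<ge> c}"
    then show "\<omega> \<in> (\<Union>F\<in>?F. ?E F)"
      using finite_particles[of N n \<omega>]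
      by (intro UN_I[of "{u \<in> particles N n \<omega>. position X u \<omega> \<in> A}"]) (auto simp: Z_def)
  next
    fix \<omega> assume "\<omega> \<in> (\<Union>F\<in>?F. ?E F)"
    then obtain F where F: "finite F" "c \<le> real (card F)" "\<omega> \<in> space M"
      and "F \<subseteq> {u \<in> particles N n \<omega>. position X u \<omega> \<in> A}" by auto
    then have "card F \<le> Z N X n \<omega> A"
      unfolding Z_def using finite_particles[of N n \<omega>] by (intro card_mono) auto
    with F show "\<omega> \<in> {\<omega> \<in> space M. real (Z N X n \<omega> A) \<ge> c}" by auto
  qed
  moreover have "countable ?F"
    by (rule countable_subset[OF _ countable_Collect_finite]) auto
  moreover have "?E F \<in> sets M" if "F \<in> ?F" for F
  proof -
    from that have "finite F" by simp
    moreover have "Measurable.pred M (\<lambda>\<omega>. u \<in> particles N n \<omega> \<and> position X u \<omega> \<in> A)" for u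
      by measurable
    ultimately have "Measurable.pred M (\<lambda>\<omega>. \<forall>u\<in>F. u \<in> particles N n \<omega> \<and> position X u \<omega> \<in> A)"
      by (rule pred_intros_finite)
    then show ?thesis by (simp add: pred_def)
  qed
  ultimately show ?thesis by (simp only:) (intro sets.countable_UN', auto)
qed

lemma integrable_offspring_iff:
  "integrable M (\<lambda>\<omega>. real (Z N X 1 \<omega> UNIV)) \<longleftrightarrow> integrable (measure_pmf p) real"
  unfolding Z_1_UNIV by (subst offspring_law[of "[]", symmetric], subst integrable_distr_eq) auto

lemma mean_offspring_eq:
  assumes "integrable M (\<lambda>\<omega>. real (Z N X 1 \<omega> UNIV))"
  shows "(\<lambda>k. real k * pmf p k) sums mean_offspring M N X"
proof -
  have i: "integrable (measure_pmf p) real" using assms integrable_offspring_iff by simp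
  have e: "mean_offspring M N X = measure_pmf.expectation p real"
    unfolding mean_offspring_def Z_1_UNIV
    by (subst offspring_law[of "[]", symmetric], subst integral_distr) auto
  have p: "measure_pmf p = density (count_space UNIV) (\<lambda>k. ennreal (pmf p k))"
    by (rule measure_pmf_eq_density)
  have "integrable (count_space UNIV) (\<lambda>k. pmf p k *\<^sub>R real k)"
    using i unfolding p by (subst (asm) integrable_density) auto
  moreover have "measure_pmf.expectation p real = (\<integral>k. pmf p k *\<^sub>R real k \<partial>count_space UNIV)"
    unfolding p by (subst integral_density) auto
  ultimately show ?thesis
    using sums_integral_count_space_nat[of "\<lambda>k. pmf p k *\<^sub>R real k"] by (simp add: e mult.commute)
qed

end

end

theory Submission
  imports Defs "HOL-Real_Asymp.Real_Asymp"
begin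

text \<open>
  Write \<open>\<xi>\<close> for a standard normal variable and \<open>\<kappa> = ln m - x\<^sup>2 / 2\<close> for the exponential growth rate of the
  expected number of particles above \<open>x n\<close>.
  
  The upper bound is Markov's inequality: the expectation of \<open>Z\<^sub>n([x n, \<infinity>))\<close> is
  \<open>m\<^sup>n P(\<xi> \<ge> x \<surd>n) \<le> exp (\<kappa> n)\<close> (lemma \<open>prob_Z_ge_upper_bound\<close>).
  
  For the lower bound, the cheap way to have \<open>exp (a n)\<close> particles above \<open>x n\<close> is one particle of
  generation \<open>n - 1\<close> that is already there and has of the order of \<open>exp (a n)\<close> children. Such a birth has
  probability of order \<open>exp (- \<beta> a n)\<close>, and a fixed proportion of the children do not move to the left. About
  \<open>exp (\<kappa> n)\<close> particles are expected to have the chance, so the probability should be at least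
  \<open>exp ((\<kappa> - \<beta> a) n)\<close>, the union bound being sharp because \<open>\<kappa> < a < \<beta> a\<close>.
  
  To make this rigorous when the offspring number may have infinite variance and when atypical
  paths could dominate second moments, only a thinned population is followed. Offspring labels
  are cut off at a constant \<open>B\<close>, time is divided into blocks of constant length \<open>l\<close>, and in each block the
  descendants are kept whose displacement over the block is at least \<open>y l\<close>, for some \<open>y\<close> slightly larger
  than \<open>x\<close>. The kept particles form a Galton--Watson process whose offspring numbers are bounded and
  have mean \<open>\<mu> = m\<^sub>B\<^sup>l P(\<xi> \<ge> y \<surd>l)\<close>, with \<open>m\<^sub>B\<close> the mean of the truncated offspring law; \<open>ln \<mu> / l\<close> comes
  arbitrarily close to \<open>\<kappa>\<close> (\<open>exists_block_with_growth_rate\<close>). Let \<open>f\<^sub>k\<close> be the probability that some particle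
  kept for \<open>k\<close> blocks has a large family. The subtrees at different vertices are independent copies of
  the whole tree, so the union bound and Bonferroni's inequality give
  \<open>\<mu> f\<^sub>k - const f\<^sub>k\<^sup>2 \<le> f\<^sub>k\<^sub>+\<^sub>1 \<le> \<mu> f\<^sub>k\<close> up to the bookkeeping of \<open>prob_hop_bounds\<close>. Solving the recursion
  (\<open>prob_relay_bounds\<close>) shows that \<open>f\<^sub>k\<close> is \<open>\<mu>\<^sup>k f\<^sub>0\<close> up to a constant, as the quadratic correction is of
  relative size \<open>f\<^sub>0 \<Sum>\<^sub>j\<^sub><\<^sub>k \<mu>\<^sup>j\<close>, at most a constant times \<open>n exp ((1 - \<beta>) a n)\<close>.
\<close>

section \<open>Independence of different parts of the tree\<close>

context branching_random_walk
begin

text \<open>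
  The offspring numbers and the displacements as one family of real random variables, so that
  independence of events can be read off from disjointness of index sets.
\<close>
definition coord :: "nat list + nat list \<Rightarrow> 'w \<Rightarrow> real" where
  "coord = case_sum (\<lambda>u \<omega>. real (N u \<omega>)) X"

lemma coord_simps [simp]: "coord (Inl u) = (\<lambda>\<omega>. real (N u \<omega>))" "coord (Inr u) = X u"
  by (simp_all add: coord_def)

lemma measurable_coord [measurable]: "coord j \<in> borel_measurable M"
  by (cases j) simp_all

lemma indep_coord: "indep_vars (\<lambda>_. borel) coord UNIV"
  unfolding indep_vars_def2
proof (intro conjI ballI indep_setsI)
  fix A J assume J: "J \<noteq> {}" "finite J"
    and "\<forall>j\<in>J. A j \<in> {coord j -` B \<inter> space M |B. B \<in> sets borel}"
  then obtain B where B: "\<And>j. j \<in> J \<Longrightarrow> A j = coord j -` B j \<inter> space M"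
      "\<And>j. j \<in> J \<Longrightarrow> B j \<in> sets borel" by (simp add: subset_eq Bex_def) metis
  \<comment> \<open>The index set J is enlarged to all coordinates of the labels that occur in it, with the
    trivial event at the new coordinates; then the product over labels can be split.\<close>
  define B' where "B' j = (if j \<in> J then B j else UNIV)" for j
  have B' [measurable]: "B' j \<in> sets borel" for j using B by (auto simp: B'_def)
  define U where "U = case_sum id id ` J"
  have U: "finite U" "U \<noteq> {}" using J by (auto simp: U_def)
  have JU: "J \<subseteq> Inl ` U \<union> Inr ` U"
  proof
    fix j assume "j \<in> J"
    then show "j \<in> Inl ` U \<union> Inr ` U"
      by (cases j) (force simp: U_def)+
  qed
  let ?P = "\<lambda>u. (\<lambda>\<omega>. (N u \<omega>, X u \<omega>)) -` ((real -` B' (Inl u)) \<times> B' (Inr u)) \<inter> space M"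
  have "(\<Inter>j\<in>J. A j) = (\<Inter>j\<in>J. coord j -` B' j \<inter> space M)"
    by (intro INF_cong) (auto simp: B B'_def)
  also have "\<dots> = (\<Inter>j\<in>Inl ` U \<union> Inr ` U. coord j -` B' j \<inter> space M)"
  proof (intro equalityI INF_superset_mono[OF JU] subsetI order_refl)
    fix \<omega> assume \<omega>: "\<omega> \<in> (\<Inter>j\<in>J. coord j -` B' j \<inter> space M)"
    then have "\<omega> \<in> space M" "\<forall>j\<in>J. coord j \<omega> \<in> B' j" using J by auto
    then show "\<omega> \<in> (\<Inter>j\<in>Inl ` U \<union> Inr ` U. coord j -` B' j \<inter> space M)"
      by (auto simp: B'_def simp del: coord_simps) 
  qed
  also have "\<dots> = (\<Inter>u\<in>U. ?P u)"
  proof (intro set_eqI)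
    fix \<omega>
    show "\<omega> \<in> (\<Inter>j\<in>Inl ` U \<union> Inr ` U. coord j -` B' j \<inter> space M) \<longleftrightarrow> \<omega> \<in> (\<Inter>u\<in>U. ?P u)"
      unfolding INT_iff ball_Un ball_simps by auto
  qed
  also have "prob \<dots> = (\<Prod>u\<in>U. prob (?P u))"
    using U by (intro indep_varsD[OF indep_particles]) auto
  also have "\<dots> = (\<Prod>u\<in>U. prob (coord (Inl u) -` B' (Inl u) \<inter> space M)
                      * prob (coord (Inr u) -` B' (Inr u) \<inter> space M))"
  proof (intro prod.cong refl)
    fix u
    have "?P u = (\<lambda>\<omega>. (real (N u \<omega>), X u \<omega>)) -` (B' (Inl u) \<times> B' (Inr u)) \<inter> space M" by auto
    then show "prob (?P u) = prob (coord (Inl u) -` B' (Inl u) \<inter> space M)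
                      * prob (coord (Inr u) -` B' (Inr u) \<inter> space M)"
      by (simp add: indep_varD[OF indep_branching_motion])
  qed
  also have "\<dots> = (\<Prod>j\<in>Inl ` U \<union> Inr ` U. prob (coord j -` B' j \<inter> space M))"
    using U by (subst prod.union_disjoint) (auto simp: prod.distrib prod.reindex)
  also have "\<dots> = (\<Prod>j\<in>J. prob (coord j -` B' j \<inter> space M))"
    using JU U by (intro prod.mono_neutral_right) (auto simp: B'_def prob_space)
  also have "\<dots> = (\<Prod>j\<in>J. prob (A j))"
    by (intro prod.cong) (auto simp: B B'_def)
  finally show "prob (\<Inter>j\<in>J. A j) = (\<Prod>j\<in>J. prob (A j))" .
qed auto

text \<open>
  The \<open>\<sigma>\<close>-algebra generated by the offspring numbers at the labels in \<open>A\<close> and the displacements at the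
  labels in \<open>B\<close>. The two label sets are separate because the arrival of a particle is decided by its
  own displacement, whereas its own offspring number belongs to its future.
\<close>
definition info :: "nat list set \<Rightarrow> nat list set \<Rightarrow> 'w measure" where
  "info A B = sigma (space M) (\<Union>j\<in>Inl ` A \<union> Inr ` B. {coord j -` S \<inter> space M | S. S \<in> sets borel})"

lemma space_info [simp]: "space (info A B) = space M"
  unfolding info_def by (rule space_measure_of) auto

lemma sets_info: "sets (info A B) =
    sigma_sets (space M) (\<Union>j\<in>Inl ` A \<union> Inr ` B. {coord j -` S \<inter> space M | S. S \<in> sets borel})"
  unfolding info_def by (rule sets_measure_of) auto

lemma sets_info_subset: "sets (info A B) \<subseteq> sets M"
  unfolding sets_info by (rule sets.sigma_sets_subset) auto

lemma measurable_info_imp: "f \<in> measurable (info A B) L \<Longrightarrow> f \<in> measurable M L"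
proof (rule measurableI)
  assume f: "f \<in> measurable (info A B) L"
  show "f x \<in> space L" if "x \<in> space M" for x
    using measurable_space[OF f, of x] that by simp
  show "f -` E \<inter> space M \<in> sets M" if "E \<in> sets L" for E
    using measurable_sets[OF f that] sets_info_subset[of A B] by auto
qed

lemma measurable_info_coord:
  "j \<in> Inl ` A \<union> Inr ` B \<Longrightarrow> coord j \<in> borel_measurable (info A B)"
  by (intro measurableI) (auto simp: sets_info intro!: sigma_sets.Basic)

lemma measurable_info_X: "u \<in> B \<Longrightarrow> X u \<in> borel_measurable (info A B)"
  using measurable_info_coord[of "Inr u"] by simp

lemma measurable_info_N: "u \<in> A \<Longrightarrow> N u \<in> measurable (info A B) (count_space UNIV)"
proof -
  assume "u \<in> A"
  then have [measurable]: "(\<lambda>\<omega>. real (N u \<omega>)) \<in> borel_measurable (info A B)"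
    using measurable_info_coord[of "Inl u"] by simp
  have "(\<lambda>\<omega>. nat \<lfloor>real (N u \<omega>)\<rfloor>) \<in> measurable (info A B) (count_space UNIV)" by measurable
  then show ?thesis by simp
qed

lemma indep_info:
  assumes "A \<inter> A' = {}" "B \<inter> B' = {}"
  shows "indep_set (sets (info A B)) (sets (info A' B'))"
proof -
  let ?E = "\<lambda>j. {coord j -` S \<inter> space M | S. S \<in> sets borel}"
  let ?I = "case_bool (Inl ` A \<union> Inr ` B) (Inl ` A' \<union> Inr ` B')"
  have "indep_sets ?E UNIV"
    using indep_coord unfolding indep_vars_def2 by (rule conjunct2)
  then have "indep_sets ?E (\<Union>b\<in>UNIV. ?I b)"
    by (rule indep_sets_mono_index[OF subset_UNIV])
  moreover have "Int_stable (?E j)" for j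
  proof (rule Int_stableI)
    fix a b assume "a \<in> ?E j" "b \<in> ?E j"
    then obtain S T where "a = coord j -` S \<inter> space M" "b = coord j -` T \<inter> space M"
      "S \<in> sets borel" "T \<in> sets borel" by auto
    then have "a \<inter> b = coord j -` (S \<inter> T) \<inter> space M" "S \<inter> T \<in> sets borel" by auto
    then show "a \<inter> b \<in> ?E j" by blast
  qed
  moreover have "disjoint_family_on ?I UNIV"
    using assms by (auto simp: disjoint_family_on_def split: bool.splits)
  ultimately have "indep_sets (\<lambda>b. sigma_sets (space M) (\<Union>j\<in>?I b. ?E j)) UNIV"
    by (rule indep_sets_collect_sigma)
  also have "(\<lambda>b. sigma_sets (space M) (\<Union>j\<in>?I b. ?E j)) = case_bool (sets (info A B)) (sets (info A' B'))"
    by (rule ext) (simp add: sets_info split: bool.split)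
  finally show ?thesis unfolding indep_set_def .
qed

lemma prob_conj_indep:
  assumes "A \<inter> A' = {}" "B \<inter> B' = {}"
    and "Measurable.pred (info A B) P" "Measurable.pred (info A' B') Q"
  shows "\<P>(\<omega> in M. P \<omega> \<and> Q \<omega>) = \<P>(\<omega> in M. P \<omega>) * \<P>(\<omega> in M. Q \<omega>)"
proof -
  have "{\<omega> \<in> space M. P \<omega>} \<in> sets (info A B)" "{\<omega> \<in> space M. Q \<omega>} \<in> sets (info A' B')"
    using assms(3,4) by (simp_all add: pred_def)
  note indep_setD[OF indep_info[OF assms(1,2)] this]
  moreover have "{\<omega> \<in> space M. P \<omega> \<and> Q \<omega>} = {\<omega> \<in> space M. P \<omega>} \<inter> {\<omega> \<in> space M. Q \<omega>}"
    by auto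
  ultimately show ?thesis by (simp only:)
qed

lemma indep_var_info:
  assumes "A \<inter> A' = {}" "B \<inter> B' = {}"
    and f: "f \<in> measurable (info A B) S" and g: "g \<in> measurable (info A' B') T"
  shows "indep_var S f T g"
  unfolding indep_var_eq
proof (intro conjI)
  show "indep_set (sigma_sets (space M) {f -` E \<inter> space M |E. E \<in> sets S})
     (sigma_sets (space M) {g -` E \<inter> space M |E. E \<in> sets T})"
    using indep_info[OF assms(1,2)] unfolding indep_set_def
  proof (rule indep_sets_mono_sets)
    have "sigma_sets (space (info A B)) {f -` E \<inter> space M |E. E \<in> sets S} \<subseteq> sets (info A B)"
      using measurable_sets[OF f] by (intro sets.sigma_sets_subset) auto
    moreover have "sigma_sets (space (info A' B')) {g -` E \<inter> space M |E. E \<in> sets T} \<subseteq> sets (info A' B')"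
      using measurable_sets[OF g] by (intro sets.sigma_sets_subset) auto
    ultimately show "case_bool (sigma_sets (space M) {f -` E \<inter> space M |E. E \<in> sets S})
          (sigma_sets (space M) {g -` E \<inter> space M |E. E \<in> sets T}) b
        \<subseteq> case_bool (sets (info A B)) (sets (info A' B')) b" for b
      by (auto split: bool.splits)
  qed
  show "random_variable S f" by (rule measurable_info_imp[OF f])
  show "random_variable T g" by (rule measurable_info_imp[OF g])
qed

text \<open>
  The branching property: the descendants of any vertex, seen from that vertex, again form a branching
  random walk with the same laws.
\<close>
lemma branching_random_walk_shift:
  "branching_random_walk M p D (\<lambda>u. N (u @ v)) (\<lambda>u. X (u @ v))"
proof -
  let ?Y = "\<lambda>u \<omega>. (N u \<omega>, X u \<omega>)" and ?S = "count_space UNIV \<Otimes>\<^sub>M (borel :: real measure)"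
  let ?f = "\<lambda>u. u @ v"
  have "indep_vars (\<lambda>_. ?S) (\<lambda>u. ?Y (?f u)) UNIV"
    unfolding indep_vars_def2
  proof (intro conjI ballI indep_setsI)
    fix A J assume J: "J \<noteq> {}" "finite J"
      and "\<forall>j\<in>J. A j \<in> {?Y (?f j) -` B \<inter> space M |B. B \<in> sets ?S}"
    then obtain B where B: "\<And>j. j \<in> J \<Longrightarrow> A j = ?Y (?f j) -` B j \<inter> space M"
        "\<And>j. j \<in> J \<Longrightarrow> B j \<in> sets ?S" by (simp add: subset_eq Bex_def) metis
    define g where "g = the_inv_into J ?f"
    have g: "g (?f j) = j" if "j \<in> J" for j
      unfolding g_def using that by (intro the_inv_into_f_f) (auto simp: inj_on_def)
    have "(\<Inter>j\<in>J. A j) = (\<Inter>i\<in>?f ` J. ?Y i -` B (g i) \<inter> space M)"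
      by (auto simp: B g)
    also have "prob \<dots> = (\<Prod>i\<in>?f ` J. prob (?Y i -` B (g i) \<inter> space M))"
      using J B by (intro indep_varsD[OF indep_particles]) (auto simp: g)
    also have "\<dots> = (\<Prod>j\<in>J. prob (A j))"
      by (subst prod.reindex) (auto simp: inj_on_def g B intro!: prod.cong)
    finally show "prob (\<Inter>j\<in>J. A j) = (\<Prod>j\<in>J. prob (A j))" .
  qed auto
  then show ?thesis
    unfolding branching_random_walk_def branching_random_walk_axioms_def
    by (intro conjI allI) (assumption | rule prob_space_axioms indep_branching_motion offspring_law step_law)+
qed

end

section \<open>Lineages and shifted trees\<close>

lemma length_particles: "u \<in> particles N n \<omega> \<Longrightarrow> length u = n"
  by (induction n arbitrary: u) auto

lemma particles_append:
  "u @ v \<in> particles N (length u + length v) \<omega> \<longleftrightarrow>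
     v \<in> particles N (length v) \<omega> \<and> u \<in> particles (\<lambda>u. N (u @ v)) (length u) \<omega>"
  by (induction u) auto

lemma position_append:
  "position X (u @ v) \<omega> = position (\<lambda>u. X (u @ v)) u \<omega> + position X v \<omega>"
  by (induction u) auto

lemma pred_particles:
  assumes "\<And>u. length u < n \<Longrightarrow> N u \<in> measurable G (count_space UNIV)"
  shows "Measurable.pred G (\<lambda>\<omega>. u \<in> particles N n \<omega>)"
  using assms
proof (induction n arbitrary: u)
  case (Suc n)
  show ?case
  proof (cases "\<exists>i v. u = i # v \<and> length v = n")
    case True
    then obtain i v where u: "u = i # v" "length v = n" by auto
    have [measurable]: "Measurable.pred G (\<lambda>\<omega>. v \<in> particles N n \<omega>)"
      "N v \<in> measurable G (count_space UNIV)" using Suc u by auto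
    have "Measurable.pred G (\<lambda>\<omega>. v \<in> particles N n \<omega> \<and> i < N v \<omega>)" by measurable
    then show ?thesis by (simp add: u)
  next
    case False
    then have "(\<lambda>\<omega>. u \<in> particles N (Suc n) \<omega>) = (\<lambda>_. False)"
      by (auto dest: length_particles)
    then show ?thesis by (simp only:) simp
  qed
qed simp

lemma borel_measurable_position:
  assumes "\<And>v. v \<noteq> [] \<Longrightarrow> length v \<le> length u \<Longrightarrow> X v \<in> borel_measurable G"
  shows "position X u \<in> borel_measurable G"
  using assms
proof (induction u)
  case Nil
  have "position X [] = (\<lambda>_. 0)" by auto
  then show ?case by simp
next
  case (Cons i u)
  have "position X (i # u) = (\<lambda>\<omega>. position X u \<omega> + X (i # u) \<omega>)" by auto
  with Cons show ?case by simp
qed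

text \<open>
  The lineages along which every ancestor is among the first \<open>B\<close> siblings: a finite set, so that all sums
  and unions over particles are finite.
\<close>
definition labels :: "nat \<Rightarrow> nat \<Rightarrow> nat list set" where
  "labels B n = {w. length w = n \<and> set w \<subseteq> {..<B}}"

lemma finite_labels: "finite (labels B n)"
  using finite_lists_length_eq[of "{..<B}" n] by (simp add: labels_def conj_commute)

lemma card_labels: "card (labels B n) = B ^ n"
  using card_lists_length_eq[of "{..<B}" n] by (simp add: labels_def conj_commute)

lemma sum_labels_prod_list:
  fixes f :: "nat \<Rightarrow> real"
  shows "(\<Sum>w\<in>labels B n. prod_list (map f w)) = (\<Sum>i<B. f i) ^ n"
proof (induction n)
  case 0
  have "labels B 0 = {[]}" by (auto simp: labels_def)
  then show ?case by simp
next
  case (Suc n)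
  have "labels B (Suc n) = (\<lambda>(i, w). i # w) ` ({..<B} \<times> labels B n)"
    by (auto simp: labels_def length_Suc_conv image_def)
  moreover have "inj_on (\<lambda>(i, w). i # w) ({..<B} \<times> labels B n)" by (auto simp: inj_on_def)
  ultimately have "(\<Sum>w\<in>labels B (Suc n). prod_list (map f w))
      = (\<Sum>(i, w)\<in>{..<B} \<times> labels B n. f i * prod_list (map f w))"
    by (simp add: sum.reindex case_prod_unfold)
  also have "\<dots> = (\<Sum>i<B. f i) * (\<Sum>w\<in>labels B n. prod_list (map f w))"
    by (simp add: sum.cartesian_product[symmetric] sum_product)
  finally show ?case by (simp add: Suc)
qed

text \<open>
  The mean of the offspring number capped at \<open>B\<close>, written as the sum of the probabilities that the child
  with label \<open>i\<close> exists, which is the form in which it appears in first moments.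
\<close>
definition truncated_mean :: "nat pmf \<Rightarrow> nat \<Rightarrow> real" where
  "truncated_mean p B = (\<Sum>i<B. measure_pmf.prob p {i<..})"

section \<open>Tails of the standard normal law\<close>

definition normal_tail :: "real \<Rightarrow> real" where
  "normal_tail t = measure std_normal_distribution {t..}"

lemma emeasure_normal_tail:
  "ennreal (normal_tail t) = (\<integral>\<^sup>+x. ennreal (std_normal_density x) * indicator {t..} x \<partial>lborel)"
proof -
  interpret prob_space std_normal_distribution by (rule prob_space_normal_density) simp
  have "ennreal (normal_tail t) = emeasure std_normal_distribution {t..}"
    by (simp add: normal_tail_def emeasure_eq_measure)
  then show ?thesis by (simp add: emeasure_density)
qed

text \<open>
  Chernoff's bound without a moment generating function: moving the density by \<open>t\<close> costs at least the
  factor \<open>exp (- t\<^sup>2 / 2)\<close> on the positive half-line, since the cross term in \<open>(t + x)\<^sup>2\<close> is nonnegative.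
\<close>
lemma normal_tail_le:
  assumes "0 \<le> t"
  shows "normal_tail t \<le> exp (- t\<^sup>2 / 2)"
proof -
  have "ennreal (normal_tail t)
      = (\<integral>\<^sup>+x. ennreal (std_normal_density (t + 1 * x)) * indicator {t..} (t + 1 * x) \<partial>lborel)"
    unfolding emeasure_normal_tail
    by (subst nn_integral_real_affine[where c = 1 and t = t]) auto
  also have "\<dots> \<le> (\<integral>\<^sup>+x. ennreal (exp (- t\<^sup>2 / 2)) * ennreal (std_normal_density x) \<partial>lborel)"
  proof (intro nn_integral_mono)
    fix x :: real
    have "std_normal_density (t + x) \<le> exp (- t\<^sup>2 / 2) * std_normal_density x" if "0 \<le> x"
    proof -
      have "exp (- (t + x)\<^sup>2 / 2) \<le> exp (- t\<^sup>2 / 2) * exp (- x\<^sup>2 / 2)"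
        using that assms by (simp add: exp_add[symmetric] power2_eq_square field_simps)
      then have "(1 / sqrt (2 * pi)) * exp (- (t + x)\<^sup>2 / 2)
          \<le> (1 / sqrt (2 * pi)) * (exp (- t\<^sup>2 / 2) * exp (- x\<^sup>2 / 2))"
        by (rule mult_left_mono) simp
      then show ?thesis by (simp add: std_normal_density_def mult_ac)
    qed
    then show "ennreal (std_normal_density (t + 1 * x)) * indicator {t..} (t + 1 * x)
        \<le> ennreal (exp (- t\<^sup>2 / 2)) * ennreal (std_normal_density x)"
      by (auto simp: indicator_def ennreal_mult[symmetric] intro!: ennreal_leI)
  qed
  also have "\<dots> = ennreal (exp (- t\<^sup>2 / 2)) * (\<integral>\<^sup>+x. ennreal (std_normal_density x) \<partial>lborel)"
    by (rule nn_integral_cmult) simp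
  also have "(\<integral>\<^sup>+x. ennreal (std_normal_density x) \<partial>lborel) = 1"
    by (subst nn_integral_eq_integral) auto
  finally show ?thesis by simp
qed

text \<open>
  The mass of \<open>[t, t + 1]\<close> already suffices, and the density is smallest at the right end point.
\<close>
lemma normal_tail_ge:
  assumes "0 \<le> t"
  shows "std_normal_density (t + 1) \<le> normal_tail t"
proof -
  have "ennreal (std_normal_density (t + 1))
      = (\<integral>\<^sup>+x. ennreal (std_normal_density (t + 1)) * indicator {t..t+1} x \<partial>lborel)"
    by (subst nn_integral_cmult_indicator) auto
  also have "\<dots> \<le> (\<integral>\<^sup>+x. ennreal (std_normal_density x) * indicator {t..} x \<partial>lborel)"
  proof (intro nn_integral_mono)
    fix x :: real
    have "std_normal_density (t + 1) \<le> std_normal_density x" if "t \<le> x" "x \<le> t + 1"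
      using that assms by (simp add: std_normal_density_def divide_right_mono power_mono)
    then show "ennreal (std_normal_density (t + 1)) * indicator {t..t+1} x
        \<le> ennreal (std_normal_density x) * indicator {t..} x"
      by (auto simp: indicator_def intro!: ennreal_leI)
  qed
  also have "\<dots> = ennreal (normal_tail t)" by (rule emeasure_normal_tail[symmetric])
  finally show ?thesis
    by (subst (asm) ennreal_le_iff) (auto simp: normal_tail_def)
qed

lemma normal_tail_pos: "0 \<le> t \<Longrightarrow> 0 < normal_tail t"
  by (rule less_le_trans[OF _ normal_tail_ge]) (auto simp: normal_density_pos)

section \<open>First moments over lineages\<close>

context branching_random_walk
begin

lemma prob_N: "\<P>(\<omega> in M. Q (N u \<omega>)) = measure_pmf.prob p {k. Q k}"
proof -
  have "measure_pmf.prob p {k. Q k} = measure (distr M (count_space UNIV) (N u)) {k. Q k}"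
    by (simp add: offspring_law)
  also have "\<dots> = \<P>(\<omega> in M. Q (N u \<omega>))"
    by (subst measure_distr) (auto intro!: arg_cong[where f = prob])
  finally show ?thesis by simp
qed

lemma prob_X: "\<P>(\<omega> in M. s \<le> X u \<omega>) = measure D {s..}"
proof -
  have "measure D {s..} = measure (distr M borel (X u)) {s..}" by (simp add: step_law)
  also have "\<dots> = \<P>(\<omega> in M. s \<le> X u \<omega>)"
    by (subst measure_distr) (auto intro!: arg_cong[where f = prob])
  finally show ?thesis by simp
qed

lemma prob_particles:
  "\<P>(\<omega> in M. w \<in> particles N (length w) \<omega>) = prod_list (map (\<lambda>i. measure_pmf.prob p {i<..}) w)"
proof (induction w)
  case Nil
  then show ?case by (simp add: prob_space)
next
  case (Cons i w)
  have "\<P>(\<omega> in M. i # w \<in> particles N (length (i # w)) \<omega>)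
      = \<P>(\<omega> in M. w \<in> particles N (length w) \<omega> \<and> i < N w \<omega>)" by simp
  also have "\<dots> = \<P>(\<omega> in M. w \<in> particles N (length w) \<omega>) * \<P>(\<omega> in M. i < N w \<omega>)"
  proof (rule prob_conj_indep)
    show "{v. length v < length w} \<inter> {w} = {}" "{} \<inter> {} = {}" by auto
    show "Measurable.pred (info {v. length v < length w} {}) (\<lambda>\<omega>. w \<in> particles N (length w) \<omega>)"
      by (intro pred_particles measurable_info_N) simp
    have [measurable]: "N w \<in> measurable (info {w} {}) (count_space UNIV)"
      by (intro measurable_info_N) simp
    show "Measurable.pred (info {w} {}) (\<lambda>\<omega>. i < N w \<omega>)" by measurable
  qed
  also have "\<P>(\<omega> in M. i < N w \<omega>) = measure_pmf.prob p {i<..}"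
    by (simp add: prob_N greaterThan_def)
  finally show ?case by (simp add: Cons)
qed

lemma prob_particles_position:
  "\<P>(\<omega> in M. w \<in> particles N (length w) \<omega> \<and> s \<le> position X w \<omega>)
     = prod_list (map (\<lambda>i. measure_pmf.prob p {i<..}) w) * \<P>(\<omega> in M. s \<le> position X w \<omega>)"
proof -
  have [measurable]: "position X w \<in> borel_measurable (info {} UNIV)"
    by (intro borel_measurable_position measurable_info_X) simp
  show ?thesis
    unfolding prob_particles[symmetric]
  proof (rule prob_conj_indep)
    show "Measurable.pred (info UNIV {}) (\<lambda>\<omega>. w \<in> particles N (length w) \<omega>)"
      by (intro pred_particles measurable_info_N) simp
    show "Measurable.pred (info {} UNIV) (\<lambda>\<omega>. s \<le> position X w \<omega>)" by measurable
  qed auto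
qed

end

locale gaussian_brw = branching_random_walk M p std_normal_distribution N X
  for M :: "'w measure" and p N X
begin

lemma distributed_X: "distributed M lborel (X u) std_normal_density"
  unfolding distributed_def using step_law[of u] by (simp cong: distr_cong)

lemma distributed_position:
  "w \<noteq> [] \<Longrightarrow> distributed M lborel (position X w) (normal_density 0 (sqrt (length w)))"
proof (induction w)
  case (Cons i w)
  have eq: "position X (i # w) = (\<lambda>\<omega>. position X w \<omega> + X (i # w) \<omega>)" by auto
  show ?case
  proof (cases "w = []")
    case True
    then have "position X (i # w) = X (i # w)" by auto
    with distributed_X[of "i # w"] True show ?thesis by simp
  next
    case False
    have "indep_var borel (position X w) borel (X (i # w))"
    proof (rule indep_var_info)
      show "{} \<inter> {} = {}" "{v. length v \<le> length w} \<inter> {i # w} = {}" by auto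
    qed (auto intro!: borel_measurable_position measurable_info_X)
    from add_indep_normal[OF this _ _ Cons.IH[OF False] distributed_X] False
    show ?thesis by (simp add: eq add.commute)
  qed
qed simp

lemma prob_position:
  assumes "w \<noteq> []"
  shows "\<P>(\<omega> in M. s \<le> position X w \<omega>) = normal_tail (s / sqrt (length w))"
proof -
  let ?c = "sqrt (length w)"
  have c: "?c > 0" using assms by simp
  have "distributed M lborel (\<lambda>\<omega>. (position X w \<omega> - 0) / ?c) std_normal_density"
    using distributed_position[OF assms] by (subst (asm) normal_standard_normal_convert[OF c])
  then have "distr M lborel (\<lambda>\<omega>. position X w \<omega> / ?c) = std_normal_distribution"
    and [measurable]: "(\<lambda>\<omega>. position X w \<omega> / ?c) \<in> borel_measurable M"
    by (auto simp: distributed_def)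
  then have "normal_tail (s / ?c) = measure (distr M lborel (\<lambda>\<omega>. position X w \<omega> / ?c)) {s / ?c..}"
    by (simp add: normal_tail_def)
  also have "\<dots> = \<P>(\<omega> in M. s / ?c \<le> position X w \<omega> / ?c)"
    by (subst measure_distr) (auto intro!: arg_cong[where f = prob])
  also have "\<dots> = \<P>(\<omega> in M. s \<le> position X w \<omega>)"
    using c by (simp add: divide_le_cancel)
  finally show ?thesis by simp
qed

text \<open>
  The many-to-one formula: genealogy and motion are independent, the probability that a lineage exists
  is a product over its generations, and the displacement along a lineage is a centred normal variable
  of variance \<open>n\<close>.
\<close>
lemma sum_prob_particles_position:
  assumes "0 < n"
  shows "(\<Sum>w\<in>labels B n. \<P>(\<omega> in M. w \<in> particles N n \<omega> \<and> s \<le> position X w \<omega>))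
    = truncated_mean p B ^ n * normal_tail (s / sqrt n)"
proof -
  have "(\<Sum>w\<in>labels B n. \<P>(\<omega> in M. w \<in> particles N n \<omega> \<and> s \<le> position X w \<omega>))
      = (\<Sum>w\<in>labels B n. prod_list (map (\<lambda>i. measure_pmf.prob p {i<..}) w) * normal_tail (s / sqrt n))"
  proof (intro sum.cong refl)
    fix w assume "w \<in> labels B n"
    then have "length w = n" "w \<noteq> []" using assms by (auto simp: labels_def)
    then show "\<P>(\<omega> in M. w \<in> particles N n \<omega> \<and> s \<le> position X w \<omega>)
      = prod_list (map (\<lambda>i. measure_pmf.prob p {i<..}) w) * normal_tail (s / sqrt n)"
      using prob_particles_position[of w s] prob_position[of w s] by simp
  qed
  then show ?thesis
    by (simp add: truncated_mean_def sum_distrib_right[symmetric] sum_labels_prod_list)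
qed

end

section \<open>The recursion over blocks\<close>

text \<open>
  Bonferroni's lower bound, with every pair counted twice.
\<close>
lemma (in prob_space) prob_UN_ge_pairs:
  assumes "finite I" "\<And>i. i \<in> I \<Longrightarrow> E i \<in> events"
  shows "(\<Sum>i\<in>I. prob (E i)) - (\<Sum>i\<in>I. \<Sum>j\<in>I - {i}. prob (E i \<inter> E j)) \<le> prob (\<Union>i\<in>I. E i)"
  using assms
proof (induction I)
  case (insert x I)
  let ?U = "\<Union>i\<in>I. E i" and ?S = "\<Sum>i\<in>I. \<Sum>j\<in>I - {i}. prob (E i \<inter> E j)"
  have ev: "E x \<in> events" "?U \<in> events" using insert by auto
  have "prob (E x \<inter> ?U) \<le> (\<Sum>j\<in>I. prob (E x \<inter> E j))"
    using insert unfolding Int_UN_distrib by (intro finite_measure_subadditive_finite) auto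
  moreover have "?S \<le> (\<Sum>i\<in>I. \<Sum>j\<in>insert x I - {i}. prob (E i \<inter> E j))"
    using insert by (intro sum_mono sum_mono2) auto
  moreover have "insert x I - {x} = I" using insert by auto
  moreover have "prob (E x \<union> ?U) = prob (E x) + prob ?U - prob (E x \<inter> ?U)"
    using finite_measure_Union'[OF ev] finite_measure_Diff'[OF ev(2,1)] by (simp add: Int_commute)
  ultimately show ?case using insert by simp
qed simp

text \<open>
  An event that can be evaluated in the subtree of any vertex takes the offspring numbers and the
  displacements as arguments; passing the shifted families evaluates it at that vertex.
\<close>
type_synonym 'w tree_event = "(nat list \<Rightarrow> 'w \<Rightarrow> nat) \<Rightarrow> (nat list \<Rightarrow> 'w \<Rightarrow> real) \<Rightarrow> 'w \<Rightarrow> bool"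

text \<open>
  The event does not look at the displacement of the root. Evaluated at a vertex \<open>w\<close> it is therefore
  independent of the arrival of \<open>w\<close>, which is what the recursion over blocks needs.
\<close>
definition subtree_measurable :: "'w tree_event \<Rightarrow> bool" where
  "subtree_measurable P \<longleftrightarrow>
     (\<forall>G N X. (\<forall>u. N u \<in> measurable G (count_space UNIV)) \<longrightarrow>
        (\<forall>u. u \<noteq> [] \<longrightarrow> X u \<in> borel_measurable G) \<longrightarrow> Measurable.pred G (P N X))"

text \<open>
  One block of the thinned population: some descendant \<open>l\<close> generations later, with labels below \<open>B\<close>, has
  moved by at least \<open>s\<close> and sees the event \<open>P\<close> in its subtree.
\<close>
definition hop :: "nat \<Rightarrow> nat \<Rightarrow> real \<Rightarrow> 'w tree_event \<Rightarrow> 'w tree_event" where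
  "hop B l s P N X \<omega> \<longleftrightarrow> (\<exists>w\<in>labels B l.
     (w \<in> particles N l \<omega> \<and> s \<le> position X w \<omega>) \<and> P (\<lambda>u. N (u @ w)) (\<lambda>u. X (u @ w)) \<omega>)"

text \<open>
  The large family at the end of the path: the root has more than \<open>K\<close> children, and at least \<open>c\<close> of the
  first \<open>K\<close> do not move to the left. Only a deterministic number of children is inspected so that the
  count is independent of the size of the family.
\<close>
definition burst :: "nat \<Rightarrow> real \<Rightarrow> 'w tree_event" where
  "burst K c N X \<omega> \<longleftrightarrow> K < N [] \<omega> \<and> c \<le> (\<Sum>i<K. indicator {0..} (X [i] \<omega>))"

lemma subtree_measurableD:
  "subtree_measurable P \<Longrightarrow> (\<And>u. N u \<in> measurable G (count_space UNIV)) \<Longrightarrow>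
     (\<And>u. u \<noteq> [] \<Longrightarrow> X u \<in> borel_measurable G) \<Longrightarrow> Measurable.pred G (P N X)"
  by (simp add: subtree_measurable_def)

lemma subtree_measurable_hop:
  fixes P :: "'w tree_event"
  assumes "subtree_measurable P"
  shows "subtree_measurable (hop B l s P)"
  unfolding subtree_measurable_def
proof (intro allI impI)
  fix G :: "'w measure" and N :: "nat list \<Rightarrow> 'w \<Rightarrow> nat" and X :: "nat list \<Rightarrow> 'w \<Rightarrow> real"
  assume N: "\<forall>u. N u \<in> measurable G (count_space UNIV)"
    and X: "\<forall>u. u \<noteq> [] \<longrightarrow> X u \<in> borel_measurable G"
  have 1: "Measurable.pred G (\<lambda>\<omega>. w \<in> particles N l \<omega>)" for w
    using N by (intro pred_particles) simp
  have 2: "position X w \<in> borel_measurable G" for w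
    using X by (intro borel_measurable_position) simp
  have 3: "Measurable.pred G (P (\<lambda>u. N (u @ w)) (\<lambda>u. X (u @ w)))" for w
    using N X by (intro subtree_measurableD[OF assms]) auto
  note [measurable] = 1 2 3
  have "Measurable.pred G (\<lambda>\<omega>. \<exists>w\<in>labels B l. (w \<in> particles N l \<omega> \<and> s \<le> position X w \<omega>)
      \<and> P (\<lambda>u. N (u @ w)) (\<lambda>u. X (u @ w)) \<omega>)"
    by (rule pred_intros_finite[OF finite_labels]) measurable
  then show "Measurable.pred G (hop B l s P N X)" by (simp add: hop_def[abs_def])
qed

lemma subtree_measurable_burst: "subtree_measurable (burst K c)"
  unfolding subtree_measurable_def
proof (intro allI impI)
  fix G :: "'w measure" and N :: "nat list \<Rightarrow> 'w \<Rightarrow> nat" and X :: "nat list \<Rightarrow> 'w \<Rightarrow> real"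
  assume N: "\<forall>u. N u \<in> measurable G (count_space UNIV)"
    and X: "\<forall>u. u \<noteq> [] \<longrightarrow> X u \<in> borel_measurable G"
  have [measurable]: "N [] \<in> measurable G (count_space UNIV)" "\<And>i. X [i] \<in> borel_measurable G"
    using N X by auto
  show "Measurable.pred G (burst K c N X)"
    unfolding burst_def[abs_def] by measurable
qed

lemma subtree_measurable_relay: "subtree_measurable ((hop B l s ^^ k) (burst K c))"
  by (induction k) (simp_all add: subtree_measurable_burst subtree_measurable_hop)

lemma Z_append_le:
  assumes "w \<in> particles N l \<omega>" "s \<le> position X w \<omega>"
  shows "Z (\<lambda>u. N (u @ w)) (\<lambda>u. X (u @ w)) j \<omega> {t..} \<le> Z N X (j + l) \<omega> {t + s..}"
  unfolding Z_def
proof (rule card_inj_on_le)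
  show "inj_on (\<lambda>u. u @ w) {u \<in> particles (\<lambda>u. N (u @ w)) j \<omega>. position (\<lambda>u. X (u @ w)) u \<omega> \<in> {t..}}"
    by (simp add: inj_on_def)
  show "(\<lambda>u. u @ w) ` {u \<in> particles (\<lambda>u. N (u @ w)) j \<omega>. position (\<lambda>u. X (u @ w)) u \<omega> \<in> {t..}}
      \<subseteq> {u \<in> particles N (j + l) \<omega>. position X u \<omega> \<in> {t + s..}}"
    using assms length_particles[of _ _ _ \<omega>] by (auto simp: position_append) (metis particles_append length_particles)
  show "finite {u \<in> particles N (j + l) \<omega>. position X u \<omega> \<in> {t + s..}}"
    using finite_particles[of N "j + l" \<omega>] by simp
qed

text \<open>
  Particles that are counted in the subtree of a kept descendant are counted in the whole tree, at a
  level shifted by the displacement of that descendant.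
\<close>
lemma hop_imp_Z_ge:
  assumes "\<And>N X. P N X \<omega> \<Longrightarrow> c \<le> real (Z N X j \<omega> {t..})" and "hop B l s P N X \<omega>"
  shows "c \<le> real (Z N X (j + l) \<omega> {t + s..})"
proof -
  from assms(2) obtain w where w: "w \<in> particles N l \<omega>" "s \<le> position X w \<omega>"
      "P (\<lambda>u. N (u @ w)) (\<lambda>u. X (u @ w)) \<omega>"
    by (auto simp: hop_def)
  have "c \<le> real (Z (\<lambda>u. N (u @ w)) (\<lambda>u. X (u @ w)) j \<omega> {t..})" by (rule assms(1)[OF w(3)])
  also have "\<dots> \<le> real (Z N X (j + l) \<omega> {t + s..})" using Z_append_le[OF w(1,2)] by simp
  finally show ?thesis .
qed

lemma burst_imp_Z_ge:
  assumes "burst K c N X \<omega>"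
  shows "c \<le> real (Z N X 1 \<omega> {0..})"
proof -
  have "c \<le> (\<Sum>i<K. indicator {0..} (X [i] \<omega>))" using assms by (simp add: burst_def)
  also have "\<dots> = real (card {i \<in> {..<K}. 0 \<le> X [i] \<omega>})"
    by (simp add: indicator_def sum.If_cases Int_def)
  also have "card {i \<in> {..<K}. 0 \<le> X [i] \<omega>} \<le> Z N X 1 \<omega> {0..}"
    unfolding Z_def
  proof (rule card_inj_on_le[where f = "\<lambda>i. [i]"])
    show "(\<lambda>i. [i]) ` {i \<in> {..<K}. 0 \<le> X [i] \<omega>} \<subseteq> {u \<in> particles N 1 \<omega>. position X u \<omega> \<in> {0..}}"
      using assms by (auto simp: burst_def)
    show "finite {u \<in> particles N 1 \<omega>. position X u \<omega> \<in> {0..}}"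
      using finite_particles[of N 1 \<omega>] by simp
  qed (simp add: inj_on_def)
  finally show ?thesis by simp
qed

lemma relay_imp_Z_ge:
  "(hop B l s ^^ k) (burst K c) N X \<omega> \<Longrightarrow> c \<le> real (Z N X (1 + k * l) \<omega> {real k * s..})"
proof (induction k arbitrary: N X)
  case 0
  then show ?case using burst_imp_Z_ge[of K c N X \<omega>] by simp
next
  case (Suc k)
  have "hop B l s ((hop B l s ^^ k) (burst K c)) N X \<omega>" using Suc.prems by simp
  from hop_imp_Z_ge[OF Suc.IH this] show ?case by (simp add: algebra_simps)
qed

context gaussian_brw
begin

lemma gaussian_brw_shift: "gaussian_brw M p (\<lambda>u. N (u @ v)) (\<lambda>u. X (u @ v))"
  unfolding gaussian_brw_def by (rule branching_random_walk_shift)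

lemma prob_burst_le: "\<P>(\<omega> in M. burst K c N X \<omega>) \<le> measure_pmf.prob p {K<..}"
proof -
  have "\<P>(\<omega> in M. burst K c N X \<omega>) \<le> \<P>(\<omega> in M. K < N [] \<omega>)"
    by (intro finite_measure_mono) (auto simp: burst_def)
  then show ?thesis by (simp add: prob_N greaterThan_def)
qed

text \<open>
  Among \<open>K\<close> children the expected proportion of those that do not move to the left is \<open>q\<close>. A variable with
  values in \<open>[0, K]\<close> and mean \<open>q K\<close> reaches half of its mean with probability at least \<open>q / 2\<close>.
\<close>
lemma prob_burst_ge:
  assumes "0 < K"
  defines "q \<equiv> normal_tail 0"
  shows "q / 2 * measure_pmf.prob p {K<..} \<le> \<P>(\<omega> in M. burst K (q * K / 2) N X \<omega>)"
proof -
  define S :: "'w \<Rightarrow> real" where "S \<omega> = (\<Sum>i<K. indicator {0..} (X [i] \<omega>))" for \<omega>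
  have [measurable]: "S \<in> borel_measurable M" unfolding S_def[abs_def] by measurable
  define A where "A = {\<omega> \<in> space M. q * K / 2 \<le> S \<omega>}"
  have A: "A \<in> events" unfolding A_def by measurable
  have intA: "integrable M (indicat_real A)"
    using A by (intro integrable_real_indicator) (auto simp: emeasure_eq_measure)
  have S: "0 \<le> S \<omega>" "S \<omega> \<le> K" for \<omega>
    unfolding S_def using sum_bounded_above[of "{..<K}" "\<lambda>i. indicator {0..} (X [i] \<omega>) :: real" 1]
    by (auto intro!: sum_nonneg simp: indicator_def)
  have int: "integrable M (\<lambda>\<omega>. indicator {0..} (X [i] \<omega>) :: real)" for i
    by (rule integrable_const_bound[of _ 1]) auto
  have "0 \<le> q * K" by (simp add: q_def normal_tail_def)
  have "expectation (\<lambda>\<omega>. indicator {0..} (X [i] \<omega>) :: real) = q" for i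
  proof -
    have "expectation (\<lambda>\<omega>. indicator {0..} (X [i] \<omega>) :: real)
        = expectation (indicator {\<omega> \<in> space M. 0 \<le> X [i] \<omega>})"
      by (intro Bochner_Integration.integral_cong) (auto simp: indicator_def)
    also have "\<dots> = \<P>(\<omega> in M. 0 \<le> X [i] \<omega>)" by simp
    finally show ?thesis by (simp add: prob_X q_def normal_tail_def)
  qed
  then have "expectation S = K * q"
    unfolding S_def[abs_def] using int by (simp add: Bochner_Integration.integral_sum)
  moreover have "expectation S \<le> expectation (\<lambda>\<omega>. real K * indicator A \<omega> + q * K / 2)"
  proof (rule integral_mono)
    show "integrable M S" using S by (intro integrable_const_bound[of _ K]) auto
    show "integrable M (\<lambda>\<omega>. real K * indicator A \<omega> + q * K / 2)"
      by (intro integrable_const_bound[of _ "K + q * K / 2"]) (use A in \<open>auto simp: indicator_def q_def normal_tail_def\<close>)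
    show "S \<omega> \<le> real K * indicator A \<omega> + q * K / 2" if "\<omega> \<in> space M" for \<omega>
      using S[of \<omega>] that \<open>0 \<le> q * K\<close> by (auto simp: A_def indicator_def simp del: zero_le_mult_iff)
  qed
  moreover have "expectation (\<lambda>\<omega>. real K * indicator A \<omega> + q * K / 2)
      = K * prob A + q * K / 2"
    using intA A by (simp add: prob_space)
  ultimately have "K * (q / 2) \<le> K * prob A" by (simp add: algebra_simps)
  then have half: "q / 2 \<le> prob A"
    using assms(1) by (subst (asm) mult_le_cancel_left_pos) auto
  have "\<P>(\<omega> in M. burst K (q * K / 2) N X \<omega>) = \<P>(\<omega> in M. K < N [] \<omega> \<and> q * K / 2 \<le> S \<omega>)"
    by (simp add: burst_def S_def)
  also have "\<dots> = \<P>(\<omega> in M. K < N [] \<omega>) * prob A"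
    unfolding A_def
  proof (rule prob_conj_indep)
    have [measurable]: "N [] \<in> measurable (info UNIV {}) (count_space UNIV)"
      by (intro measurable_info_N) simp
    show "Measurable.pred (info UNIV {}) (\<lambda>\<omega>. K < N [] \<omega>)" by measurable
    have [measurable]: "X [i] \<in> borel_measurable (info {} UNIV)" for i
      by (intro measurable_info_X) simp
    show "Measurable.pred (info {} UNIV) (\<lambda>\<omega>. q * K / 2 \<le> S \<omega>)"
      unfolding S_def by measurable
  qed auto
  also have "\<P>(\<omega> in M. K < N [] \<omega>) = measure_pmf.prob p {K<..}"
    by (simp add: prob_N greaterThan_def)
  finally show ?thesis
    using mult_left_mono[OF half, of "measure_pmf.prob p {K<..}"] by (simp add: mult.commute)
qed

text \<open>
  The recursion step. Whether a descendant is kept depends on the generations before it and on its own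
  displacement, and so is independent of \<open>P\<close> in its subtree; with the many-to-one formula this yields the
  upper bound by subadditivity and the linear term of the lower bound. For two distinct descendants
  the subtrees are disjoint, so both see \<open>P\<close> with probability at most \<open>U\<^sup>2\<close>. For \<open>B = 1\<close> there is only one
  descendant, and the correction vanishes.
\<close>
lemma prob_hop_bounds:
  fixes s :: real and B :: nat
  assumes P: "subtree_measurable P" and l: "0 < l"
    and bounds: "\<And>N X. gaussian_brw M p N X \<Longrightarrow> L \<le> \<P>(\<omega> in M. P N X \<omega>) \<and> \<P>(\<omega> in M. P N X \<omega>) \<le> U"
  defines "\<mu> \<equiv> truncated_mean p B ^ l * normal_tail (s / sqrt l)"
  shows "\<P>(\<omega> in M. hop B l s P N X \<omega>) \<le> \<mu> * U"
    and "\<mu> * L - real (B ^ l) * real (B ^ l - 1) * U\<^sup>2 \<le> \<P>(\<omega> in M. hop B l s P N X \<omega>)"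
proof -
  define kept where "kept w \<omega> \<longleftrightarrow> w \<in> particles N l \<omega> \<and> s \<le> position X w \<omega>" for w \<omega>
  define Q where "Q w = P (\<lambda>u. N (u @ w)) (\<lambda>u. X (u @ w))" for w
  define E where "E w = {\<omega> \<in> space M. kept w \<omega> \<and> Q w \<omega>}" for w
  have [measurable]: "Measurable.pred M (kept w)" for w
    unfolding kept_def[abs_def] by measurable
  have [measurable]: "Measurable.pred M (Q w)" for w
    unfolding Q_def by (rule subtree_measurableD[OF P]) auto
  have Q: "L \<le> \<P>(\<omega> in M. Q w \<omega>)" "\<P>(\<omega> in M. Q w \<omega>) \<le> U" for w
    using bounds[OF gaussian_brw_shift[of w]] by (auto simp: Q_def)
  have prob_E: "prob (E w) = \<P>(\<omega> in M. kept w \<omega>) * \<P>(\<omega> in M. Q w \<omega>)" if "w \<in> labels B l" for w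
    unfolding E_def
  proof (rule prob_conj_indep)
    show "{u. length u < l} \<inter> {u. l \<le> length u} = {}" "{u. length u \<le> l} \<inter> {u. l < length u} = {}"
      by auto
    have w: "length w = l" using that by (simp add: labels_def)
    have [measurable]: "Measurable.pred (info {u. length u < l} {u. length u \<le> l}) (\<lambda>\<omega>. w \<in> particles N l \<omega>)"
      by (intro pred_particles measurable_info_N) simp
    have [measurable]: "position X w \<in> borel_measurable (info {u. length u < l} {u. length u \<le> l})"
      using w by (intro borel_measurable_position measurable_info_X) simp
    show "Measurable.pred (info {u. length u < l} {u. length u \<le> l}) (kept w)"
      unfolding kept_def[abs_def] by measurable
    show "Measurable.pred (info {u. l \<le> length u} {u. l < length u}) (Q w)"
      unfolding Q_def using w by (intro subtree_measurableD[OF P] measurable_info_N measurable_info_X) auto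
  qed
  have prob_pair: "prob (E v \<inter> E w) \<le> U\<^sup>2" if "v \<in> labels B l" "w \<in> labels B l" "v \<noteq> w" for v w
  proof -
    have "prob (E v \<inter> E w) \<le> \<P>(\<omega> in M. Q v \<omega> \<and> Q w \<omega>)"
      by (intro finite_measure_mono) (auto simp: E_def)
    also have "\<dots> = \<P>(\<omega> in M. Q v \<omega>) * \<P>(\<omega> in M. Q w \<omega>)"
    proof (rule prob_conj_indep)
      show "range (\<lambda>u. u @ v) \<inter> range (\<lambda>u. u @ w) = {}" "range (\<lambda>u. u @ v) \<inter> range (\<lambda>u. u @ w) = {}"
        using that by (auto simp: labels_def)
      show "Measurable.pred (info (range (\<lambda>u. u @ v)) (range (\<lambda>u. u @ v))) (Q v)" for v
        unfolding Q_def by (intro subtree_measurableD[OF P] measurable_info_N measurable_info_X) auto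
      then show "Measurable.pred (info (range (\<lambda>u. u @ w)) (range (\<lambda>u. u @ w))) (Q w)" .
    qed
    also have "\<dots> \<le> U\<^sup>2"
      unfolding power2_eq_square using Q(2) by (intro mult_mono order_trans[OF measure_nonneg Q(2)]) auto
    finally show ?thesis .
  qed
  have sum_kept: "(\<Sum>w\<in>labels B l. \<P>(\<omega> in M. kept w \<omega>)) = \<mu>"
    unfolding kept_def \<mu>_def by (rule sum_prob_particles_position[OF l])
  have hop: "{\<omega> \<in> space M. hop B l s P N X \<omega>} = (\<Union>w\<in>labels B l. E w)"
    by (auto simp: hop_def E_def kept_def Q_def)
  have E_events: "E w \<in> events" for w unfolding E_def by measurable
  have "prob (\<Union>w\<in>labels B l. E w) \<le> (\<Sum>w\<in>labels B l. prob (E w))"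
    using E_events by (intro finite_measure_subadditive_finite finite_labels) auto
  also have "\<dots> \<le> (\<Sum>w\<in>labels B l. \<P>(\<omega> in M. kept w \<omega>) * U)"
    using Q by (intro sum_mono) (simp add: prob_E mult_left_mono)
  also have "\<dots> = \<mu> * U" by (simp add: sum_distrib_right[symmetric] sum_kept)
  finally show "\<P>(\<omega> in M. hop B l s P N X \<omega>) \<le> \<mu> * U" by (simp add: hop)
  have "\<mu> * L = (\<Sum>w\<in>labels B l. \<P>(\<omega> in M. kept w \<omega>) * L)"
    by (simp add: sum_distrib_right[symmetric] sum_kept)
  also have "\<dots> \<le> (\<Sum>w\<in>labels B l. prob (E w))"
    using Q by (intro sum_mono) (simp add: prob_E mult_left_mono)
  finally have 1: "\<mu> * L \<le> (\<Sum>w\<in>labels B l. prob (E w))" .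
  have "(\<Sum>v\<in>labels B l. \<Sum>w\<in>labels B l - {v}. prob (E v \<inter> E w))
      \<le> (\<Sum>v\<in>labels B l. \<Sum>w\<in>labels B l - {v}. U\<^sup>2)"
    by (intro sum_mono prob_pair) auto
  also have "\<dots> = real (B ^ l) * real (B ^ l - 1) * U\<^sup>2"
    by (simp add: card_Diff_singleton card_labels finite_labels)
  finally show "\<mu> * L - real (B ^ l) * real (B ^ l - 1) * U\<^sup>2 \<le> \<P>(\<omega> in M. hop B l s P N X \<omega>)"
    using 1 prob_UN_ge_pairs[of "labels B l" E, OF finite_labels E_events] unfolding hop by linarith
qed

end

text \<open>
  The solution of the recursion. Dividing the lower bound by \<open>\<mu>\<^sup>k\<close> turns the step from \<open>k\<close> to \<open>k + 1\<close> into the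
  subtraction of a constant multiple of \<open>\<mu>\<^sup>k Q\<^sup>2\<close>, so the corrections add up to a geometric sum.
\<close>
lemma prob_relay_bounds:
  fixes s :: real and B :: nat
  assumes "gaussian_brw M p N X" and l: "0 < l" and K: "0 < K"
  defines "\<mu> \<equiv> truncated_mean p B ^ l * normal_tail (s / sqrt l)"
    and "q \<equiv> normal_tail 0" and "Q \<equiv> measure_pmf.prob p {K<..}"
  assumes \<mu>: "0 < \<mu>"
  shows "\<P>(\<omega> in M. (hop B l s ^^ k) (burst K (q * K / 2)) N X \<omega>) \<le> \<mu> ^ k * Q"
    and "\<mu> ^ k * (q / 2 * Q - (B ^ l)\<^sup>2 / \<mu> * Q\<^sup>2 * (\<Sum>j<k. \<mu> ^ j))
           \<le> \<P>(\<omega> in M. (hop B l s ^^ k) (burst K (q * K / 2)) N X \<omega>)"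
proof -
  let ?R = "\<lambda>k. (hop B l s ^^ k) (burst K (q * K / 2))"
  let ?L = "\<lambda>k. \<mu> ^ k * (q / 2 * Q - (B ^ l)\<^sup>2 / \<mu> * Q\<^sup>2 * (\<Sum>j<k. \<mu> ^ j))"
  have "?L k \<le> \<P>(\<omega> in M. ?R k N X \<omega>) \<and> \<P>(\<omega> in M. ?R k N X \<omega>) \<le> \<mu> ^ k * Q"
    using assms(1)
  proof (induction k arbitrary: N X)
    case 0
    then interpret gaussian_brw M p N X .
    show ?case using prob_burst_le prob_burst_ge[OF K] by (simp add: q_def Q_def)
  next
    case (Suc k)
    then interpret gaussian_brw M p N X by blast
    note B = prob_hop_bounds[OF subtree_measurable_relay l Suc.IH, where B = B and s = s, folded \<mu>_def]
    have "?L (Suc k) = \<mu> * ?L k - real (B ^ l) * real (B ^ l) * (\<mu> ^ k * Q)\<^sup>2"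
      using \<mu> by (simp add: field_simps power2_eq_square)
    also have "\<dots> \<le> \<mu> * ?L k - real (B ^ l) * real (B ^ l - 1) * (\<mu> ^ k * Q)\<^sup>2"
      by (intro diff_left_mono mult_mono) auto
    finally show ?case using B by simp
  qed
  then show "?L k \<le> \<P>(\<omega> in M. ?R k N X \<omega>)" "\<P>(\<omega> in M. ?R k N X \<omega>) \<le> \<mu> ^ k * Q" by auto
qed

section \<open>Bounds for a fixed generation\<close>

lemma truncated_mean_eq: "truncated_mean p B = measure_pmf.expectation p (\<lambda>k. real (min k B))"
proof -
  have "real (min k B) = (\<Sum>i<B. indicator {i<..} k)" for k
    by (induction B) (auto simp: min_def indicator_def)
  then have "measure_pmf.expectation p (\<lambda>k. real (min k B))
      = measure_pmf.expectation p (\<lambda>k. \<Sum>i<B. indicat_real {i<..} k)" by (simp only:)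
  also have "\<dots> = (\<Sum>i<B. measure_pmf.expectation p (indicat_real {i<..}))"
    by (intro Bochner_Integration.integral_sum measure_pmf.integrable_const_bound[of _ 1]) auto
  finally show ?thesis by (simp add: truncated_mean_def)
qed

lemma truncated_mean_le:
  assumes "integrable (measure_pmf p) real"
  shows "truncated_mean p B \<le> measure_pmf.expectation p real"
  unfolding truncated_mean_eq
  by (intro integral_mono assms measure_pmf.integrable_const_bound[of _ "real B"]) auto

lemma truncated_mean_tendsto:
  assumes "integrable (measure_pmf p) real"
  shows "truncated_mean p \<longlonglongrightarrow> measure_pmf.expectation p real"
  unfolding truncated_mean_eq[abs_def]
proof (rule integral_dominated_convergence[where w = real])
  show "AE k in measure_pmf p. (\<lambda>B. real (min k B)) \<longlonglongrightarrow> real k"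
  proof (intro AE_I2 tendsto_eventually)
    fix k show "\<forall>\<^sub>F B in sequentially. real (min k B) = real k"
      using eventually_ge_at_top[of k] by eventually_elim simp
  qed
qed (use assms in auto)

context branching_random_walk
begin

lemma mean_offspring_eq_expectation: "mean_offspring M N X = measure_pmf.expectation p real"
  unfolding mean_offspring_def Z_1_UNIV
  by (subst offspring_law[of "[]", symmetric], subst integral_distr) auto

end

context gaussian_brw
begin

text \<open>
  The first moment bound. Markov's inequality is applied to the particles with labels below \<open>B\<close>; as \<open>B\<close>
  tends to infinity they exhaust the finite generation, so the bound passes to the limit by continuity
  of the measure.
\<close>
lemma prob_Z_ge_le:
  assumes n: "0 < n" and c: "0 < c" and p: "integrable (measure_pmf p) real"
  shows "\<P>(\<omega> in M. c \<le> real (Z N X n \<omega> {s..}))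
    \<le> measure_pmf.expectation p real ^ n * normal_tail (s / sqrt n) / c"
proof -
  define kept where "kept w \<omega> \<longleftrightarrow> w \<in> particles N n \<omega> \<and> s \<le> position X w \<omega>" for w \<omega>
  have [measurable]: "Measurable.pred M (kept w)" for w
    unfolding kept_def[abs_def] by measurable
  define S :: "nat \<Rightarrow> 'w \<Rightarrow> real" where
    "S B \<omega> = (\<Sum>w\<in>labels B n. indicator {\<omega> \<in> space M. kept w \<omega>} \<omega>)" for B \<omega>
  have [measurable]: "S B \<in> borel_measurable M" for B
    unfolding S_def[abs_def] by measurable
  define F where "F B = {\<omega> \<in> space M. c \<le> S B \<omega>}" for B
  have F_events: "F B \<in> events" for B unfolding F_def by measurable
  have labels_mono: "labels B n \<subseteq> labels B' n" if "B \<le> B'" for B B'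
    using that by (auto simp: labels_def)
  have S_card: "S B \<omega> = card {w \<in> labels B n. kept w \<omega>}" if "\<omega> \<in> space M" for B \<omega>
    using that by (simp add: S_def indicator_def sum.If_cases finite_labels Int_def)
  have "incseq F"
  proof (rule incseq_SucI, rule subsetI)
    fix B \<omega> assume "\<omega> \<in> F B"
    moreover have "S B \<omega> \<le> S (Suc B) \<omega>"
      unfolding S_def using labels_mono[of B "Suc B"] by (intro sum_mono2 finite_labels) auto
    ultimately show "\<omega> \<in> F (Suc B)" by (simp add: F_def)
  qed
  moreover have "(\<Union>B. F B) = {\<omega> \<in> space M. c \<le> real (Z N X n \<omega> {s..})}"
  proof (intro equalityI subsetI)
    fix \<omega> assume "\<omega> \<in> (\<Union>B. F B)"
    then obtain B where B: "\<omega> \<in> space M" "c \<le> real (card {w \<in> labels B n. kept w \<omega>})"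
      by (auto simp: F_def S_card)
    have "card {w \<in> labels B n. kept w \<omega>} \<le> Z N X n \<omega> {s..}"
      unfolding Z_def kept_def using finite_particles[of N n \<omega>] by (intro card_mono) auto
    with B show "\<omega> \<in> {\<omega> \<in> space M. c \<le> real (Z N X n \<omega> {s..})}" by auto
  next
    fix \<omega> assume \<omega>: "\<omega> \<in> {\<omega> \<in> space M. c \<le> real (Z N X n \<omega> {s..})}"
    have "finite (\<Union>w\<in>particles N n \<omega>. set w)"
      using finite_particles[of N n \<omega>] by (intro finite_UN_I) auto
    then obtain B where B: "(\<Union>w\<in>particles N n \<omega>. set w) \<subseteq> {..<B}"
      using finite_nat_iff_bounded by blast
    then have "particles N n \<omega> \<subseteq> labels B n"
      by (auto simp: labels_def dest: length_particles)
    then have "{w \<in> labels B n. kept w \<omega>} = {u \<in> particles N n \<omega>. position X u \<omega> \<in> {s..}}"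
      by (auto simp: kept_def)
    then have "\<omega> \<in> F B" using \<omega> by (simp add: F_def S_card Z_def)
    then show "\<omega> \<in> (\<Union>B. F B)" by blast
  qed
  ultimately have "(\<lambda>B. prob (F B)) \<longlonglongrightarrow> \<P>(\<omega> in M. c \<le> real (Z N X n \<omega> {s..}))"
    using finite_Lim_measure_incseq[of F] F_events by auto
  moreover have "prob (F B) \<le> measure_pmf.expectation p real ^ n * normal_tail (s / sqrt n) / c" for B
  proof -
    have int: "integrable M (indicat_real (F B))"
      using F_events by (intro integrable_real_indicator) (auto simp: emeasure_eq_measure)
    have "c * prob (F B) = expectation (\<lambda>\<omega>. c * indicator (F B) \<omega>)"
      using F_events by simp
    also have "\<dots> \<le> expectation (S B)"
    proof (rule integral_mono)
      show "integrable M (\<lambda>\<omega>. c * indicator (F B) \<omega>)" using int by simp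
      show "integrable M (S B)"
        unfolding S_def[abs_def]
        by (intro Bochner_Integration.integrable_sum integrable_real_indicator)
           (auto simp: emeasure_eq_measure)
      show "c * indicator (F B) \<omega> \<le> S B \<omega>" for \<omega>
        using c by (auto simp: indicator_def F_def S_def intro!: sum_nonneg)
    qed
    also have "\<dots> = (\<Sum>w\<in>labels B n. \<P>(\<omega> in M. kept w \<omega>))"
      unfolding S_def[abs_def]
      by (subst Bochner_Integration.integral_sum)
         (auto simp: emeasure_eq_measure intro!: integrable_real_indicator)
    also have "\<dots> = truncated_mean p B ^ n * normal_tail (s / sqrt n)"
      unfolding kept_def by (rule sum_prob_particles_position[OF n])
    also have "\<dots> \<le> measure_pmf.expectation p real ^ n * normal_tail (s / sqrt n)"
      by (intro mult_right_mono power_mono truncated_mean_le p)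
         (auto simp: normal_tail_def truncated_mean_def intro!: sum_nonneg)
    finally show ?thesis using c by (simp add: field_simps)
  qed
  ultimately show ?thesis by (intro LIMSEQ_le_const2) auto
qed

text \<open>
  Blocks of length \<open>l\<close> only reach generations \<open>k l\<close>. The remaining \<open>r\<close> generations are spent at the beginning on
  the line of first children, which exists almost surely since every particle has a child; its
  displacement is nonnegative with probability \<open>q\<close>. One more generation is the large family.
\<close>
lemma prob_Z_ge_ge:
  fixes s t c q Q \<mu> :: real and B l k r K n :: nat
  assumes p: "pmf p 0 = 0" and "0 < l" "0 < K" and r: "0 < r" and n: "n = 1 + k * l + r"
  defines "\<mu> \<equiv> truncated_mean p B ^ l * normal_tail (s / sqrt l)"
    and "q \<equiv> normal_tail 0" and "Q \<equiv> measure_pmf.prob p {K<..}"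
  assumes \<mu>: "0 < \<mu>" and c: "c \<le> q * K / 2" and t: "t \<le> k * s"
  shows "q * (\<mu> ^ k * (q / 2 * Q - (B ^ l)\<^sup>2 / \<mu> * Q\<^sup>2 * (\<Sum>j<k. \<mu> ^ j)))
           \<le> \<P>(\<omega> in M. c \<le> real (Z N X n \<omega> {t..}))"
proof -
  let ?R = "(hop B l s ^^ k) (burst K (q * K / 2))"
  let ?L = "\<mu> ^ k * (q / 2 * Q - (B ^ l)\<^sup>2 / \<mu> * Q\<^sup>2 * (\<Sum>j<k. \<mu> ^ j))"
  have "measure_pmf.prob p {0<..} = 1"
  proof -
    have "measure_pmf.prob p {0<..} = measure_pmf.prob p (UNIV - {0})"
      by (intro arg_cong[where f = "measure_pmf.prob p"]) auto
    also have "\<dots> = 1" using p by (subst measure_pmf.finite_measure_Diff) (auto simp: measure_pmf_single)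
    finally show ?thesis .
  qed
  then have one: "truncated_mean p (Suc 0) = 1" by (simp add: truncated_mean_def)
  have "?L \<le> \<P>(\<omega> in M. ?R N X \<omega>) \<and> \<P>(\<omega> in M. ?R N X \<omega>) \<le> \<mu> ^ k * Q"
    if "gaussian_brw M p N X" for N X
    using prob_relay_bounds[OF that \<open>0 < l\<close> \<open>0 < K\<close>, of B s k] \<mu>
    unfolding \<mu>_def q_def Q_def by blast
  from prob_hop_bounds(2)[OF subtree_measurable_relay r this, of 1 0]
  have "q * ?L \<le> \<P>(\<omega> in M. hop 1 r 0 ?R N X \<omega>)"
    by (simp add: one q_def)
  also have "\<dots> \<le> \<P>(\<omega> in M. c \<le> real (Z N X n \<omega> {t..}))"
  proof (intro finite_measure_mono subsetI)
    show "{\<omega> \<in> space M. c \<le> real (Z N X n \<omega> {t..})} \<in> events" by (rule sets_Z_ge) simp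
    fix \<omega> assume \<omega>: "\<omega> \<in> {\<omega> \<in> space M. hop 1 r 0 ?R N X \<omega>}"
    then have "q * K / 2 \<le> real (Z N X (1 + k * l + r) \<omega> {k * s + 0..})"
      by (intro hop_imp_Z_ge[OF relay_imp_Z_ge]) auto
    also have "\<dots> \<le> real (Z N X n \<omega> {t..})"
      unfolding n Z_def using t finite_particles[of N "1 + k * l + r" \<omega>]
      by (intro of_nat_mono card_mono) auto
    finally show "\<omega> \<in> {\<omega> \<in> space M. c \<le> real (Z N X n \<omega> {t..})}"
      using \<omega> c by simp
  qed
  finally show ?thesis .
qed

end

section \<open>Asymptotics\<close>

lemma elog_div_le:
  assumes "0 < n" "r \<le> exp (b * real n)"
  shows "elog r / ereal (real n) \<le> ereal b"
proof (cases "r \<le> 0")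
  case True
  then show ?thesis using assms(1) by (simp add: elog_def)
next
  case False
  then have "ln r \<le> b * real n" using assms(2) by (simp add: ln_le_cancel_iff[symmetric] del: ln_le_cancel_iff)
  then show ?thesis using False assms(1) by (simp add: elog_def field_simps)
qed

lemma elog_div_ge:
  assumes "0 < n" "0 < C" "C * exp (b * real n) \<le> r"
  shows "ereal (b + ln C / real n) \<le> elog r / ereal (real n)"
proof -
  have r: "0 < r" using assms by (intro less_le_trans[OF _ assms(3)]) simp
  have "ln (C * exp (b * real n)) \<le> ln r" using assms r by (subst ln_le_cancel_iff) auto
  then have "ln C + b * real n \<le> ln r" using assms(2) by (simp add: ln_mult)
  then have "(ln C + b * real n) / real n \<le> ln r / real n" by (intro divide_right_mono) auto
  then show ?thesis using r assms(1) by (simp add: elog_def add_divide_distrib add.commute)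
qed

text \<open>
  Let \<open>\<mu>\<close> be the product in the last inequality. By the lower bound on the normal tail, \<open>ln \<mu> / l\<close>
  is at least \<open>ln m\<^sub>B - y\<^sup>2 / 2\<close> up to an error of order
  \<open>1 / \<surd>l\<close>. The gap \<open>g\<close> between \<open>\<rho>\<close> and \<open>ln m - x\<^sup>2 / 2\<close> is spent as follows: \<open>g / 6\<close> on the choice of \<open>y\<close>, \<open>g / 3\<close>
  on the truncation of the offspring law, and the remaining \<open>g / 2\<close> on the error in \<open>l\<close>.
\<close>
lemma exists_block_with_growth_rate:
  fixes x m \<rho> :: real
  assumes "0 < x" "0 < m" "truncated_mean p \<longlonglongrightarrow> m" and \<rho>: "\<rho> < ln m - x\<^sup>2 / 2"
  obtains y B l where "x < y" "0 < l" "0 < truncated_mean p B"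
    "exp (\<rho> * real l) \<le> truncated_mean p B ^ l * normal_tail (y * sqrt l)"
proof -
  define g where "g = ln m - x\<^sup>2 / 2 - \<rho>"
  have g: "0 < g" using \<rho> by (simp add: g_def)
  define y where "y = sqrt (x\<^sup>2 + g / 3)"
  have y2: "y\<^sup>2 = x\<^sup>2 + g / 3" using g by (simp add: y_def)
  have y: "x < y" using g \<open>0 < x\<close> unfolding y_def by (intro real_less_rsqrt) simp
  have y0: "0 < y" using y \<open>0 < x\<close> by simp
  have "(\<lambda>B. ln (truncated_mean p B)) \<longlonglongrightarrow> ln m"
    using assms(2,3) by (intro tendsto_ln) auto
  then have "\<forall>\<^sub>F B in sequentially. ln m - g / 3 < ln (truncated_mean p B)"
    using g by (intro order_tendstoD) auto
  moreover have "\<forall>\<^sub>F B in sequentially. 0 < truncated_mean p B"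
    using assms(2,3) by (intro order_tendstoD) auto
  ultimately have "\<forall>\<^sub>F B in sequentially. 0 < truncated_mean p B \<and> ln m - g / 3 < ln (truncated_mean p B)"
    by eventually_elim simp
  then obtain B where B: "0 < truncated_mean p B" "ln m - g / 3 < ln (truncated_mean p B)"
    by (auto simp: eventually_sequentially)
  define C where "C = 1 / 2 + ln (sqrt (2 * pi))"
  have "\<forall>\<^sub>F l in sequentially. y * sqrt (real l) + C \<le> g / 2 * real l"
    using y0 g by real_asymp
  then have "\<forall>\<^sub>F l in sequentially. 0 < l \<and> y * sqrt (real l) + C \<le> g / 2 * real l"
    using eventually_gt_at_top[of 0] by eventually_elim simp
  then obtain l where l: "0 < l" "y * sqrt (real l) + C \<le> g / 2 * real l"
    by (auto simp: eventually_sequentially)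
  let ?z = "y * sqrt (real l)"
  have z2: "(?z + 1)\<^sup>2 = y\<^sup>2 * real l + 2 * ?z + 1" by (simp add: power2_eq_square algebra_simps)
  have "\<rho> * real l \<le> real l * (ln m - g / 3) - (?z + 1)\<^sup>2 / 2 - ln (sqrt (2 * pi))"
  proof -
    have "real l * (ln m - g / 3) - (?z + 1)\<^sup>2 / 2 - ln (sqrt (2 * pi))
        = \<rho> * real l + (g / 2 * real l - (?z + C))"
      unfolding z2 y2 C_def g_def by (simp add: field_simps)
    then show ?thesis using l(2) by linarith
  qed
  also have "\<dots> \<le> real l * ln (truncated_mean p B) - (?z + 1)\<^sup>2 / 2 - ln (sqrt (2 * pi))"
    using B(2) by (intro diff_right_mono mult_left_mono) auto
  finally have exponent: "\<rho> * real l \<le> real l * ln (truncated_mean p B) - (?z + 1)\<^sup>2 / 2 - ln (sqrt (2 * pi))" .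
  have split_exp: "exp (real l * ln (truncated_mean p B) - A / 2 - ln (sqrt (2 * pi)))
      = truncated_mean p B ^ l * (1 / sqrt (2 * pi) * exp (- A / 2))" for A
  proof -
    have "exp (- A / 2) = inverse (exp (A / 2))" using exp_minus[of "A / 2"] by simp
    moreover have "exp (real l * ln (truncated_mean p B)) = truncated_mean p B ^ l"
      using B(1) by (simp add: exp_of_nat_mult)
    moreover have "exp (ln (sqrt (2 * pi))) = sqrt (2 * pi)" by simp
    ultimately show ?thesis by (simp only: exp_diff divide_inverse mult_ac mult_1)
  qed
  have "exp (\<rho> * real l) \<le> exp (real l * ln (truncated_mean p B) - (?z + 1)\<^sup>2 / 2 - ln (sqrt (2 * pi)))"
    using exponent by simp
  also have "\<dots> = truncated_mean p B ^ l * std_normal_density (?z + 1)"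
    unfolding std_normal_density_def by (rule split_exp)
  also have "\<dots> \<le> truncated_mean p B ^ l * normal_tail ?z"
    using B(1) y0 by (intro mult_left_mono normal_tail_ge) auto
  finally show thesis using that y l(1) B(1) by blast
qed

lemma same_order_powrE:
  assumes "same_order f (\<lambda>y. y powr (- \<beta>))"
  obtains c1 c2 where "0 < c1"
    "\<forall>\<^sub>F y in at_top. c1 * y powr (- \<beta>) \<le> f y \<and> f y \<le> c2 * y powr (- \<beta>)"
proof -
  let ?h = "\<lambda>y. ereal (f y / y powr (- \<beta>))"
  have L: "0 < Liminf at_top ?h" and U: "Limsup at_top ?h < \<infinity>"
    using assms by (auto simp: same_order_def)
  obtain c1 where c1: "0 < ereal c1" "ereal c1 < Liminf at_top ?h"
    using ereal_dense2[OF L] by auto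
  obtain c2 where c2: "Limsup at_top ?h < ereal c2"
    using ereal_dense2[OF U] by auto
  have "\<forall>\<^sub>F y in at_top. ereal c1 < ?h y" by (rule less_LiminfD[OF c1(2)])
  moreover have "\<forall>\<^sub>F y in at_top. ?h y < ereal c2" by (rule Limsup_lessD[OF c2])
  ultimately have "\<forall>\<^sub>F y in at_top. c1 * y powr (- \<beta>) \<le> f y \<and> f y \<le> c2 * y powr (- \<beta>)"
    using eventually_gt_at_top[of 0]
  proof eventually_elim
    case (elim y)
    then have "0 < y powr (- \<beta>)" by simp
    with elim show ?case by (simp add: pos_less_divide_eq pos_divide_less_eq less_imp_le)
  qed
  with c1(1) that show thesis by auto
qed

context gaussian_brw
begin

lemma prob_Z_ge_upper_bound:
  fixes x a :: real
  assumes int: "integrable (measure_pmf p) real" and m: "0 < measure_pmf.expectation p real"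
    and x: "0 \<le> x" and n: "0 < n"
  shows "\<P>(\<omega> in M. exp (a * real n) \<le> real (Z N X n \<omega> {x * real n..}))
    \<le> exp (- (a - (ln (measure_pmf.expectation p real) - x\<^sup>2 / 2)) * real n)"
proof -
  let ?m = "measure_pmf.expectation p real"
  have "x * real n / sqrt (real n) = x * sqrt (real n)" by (metis of_nat_0_le_iff real_div_sqrt times_divide_eq_right)
  then have "\<P>(\<omega> in M. exp (a * real n) \<le> real (Z N X n \<omega> {x * real n..}))
      \<le> ?m ^ n * normal_tail (x * sqrt (real n)) / exp (a * real n)"
    using prob_Z_ge_le[OF n _ int, of "exp (a * real n)" "x * real n"] by simp
  also have "\<dots> \<le> ?m ^ n * exp (- (x * sqrt (real n))\<^sup>2 / 2) / exp (a * real n)"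
    using m x by (intro divide_right_mono mult_left_mono normal_tail_le) auto
  also have "\<dots> = exp (real n * ln ?m) * exp (- (x\<^sup>2 * real n) / 2) / exp (a * real n)"
    using m by (simp add: exp_of_nat_mult power_mult_distrib)
  also have "\<dots> = exp (- (a - (ln ?m - x\<^sup>2 / 2)) * real n)"
    unfolding exp_add[symmetric] exp_diff[symmetric] by (intro arg_cong[where f = exp]) (simp add: algebra_simps)
  finally show ?thesis .
qed

text \<open>
  The asymptotic form of \<open>prob_Z_ge_ge\<close>: the number of blocks grows with \<open>n\<close> while \<open>y\<close>, \<open>B\<close> and \<open>l\<close> stay fixed, and
  the size \<open>K\<close> of the large family is of order \<open>exp (a n)\<close>. The remainder of at most \<open>l\<close> generations changes the
  probability by a constant factor.
\<close>
lemma prob_Z_ge_lower_bound: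
  fixes x a m \<beta> \<rho> :: real
  assumes p0: "pmf p 0 = 0" and int: "integrable (measure_pmf p) real"
    and m_def: "m = measure_pmf.expectation p real" and m: "0 < m"
    and \<beta>: "1 < \<beta>" and tail: "same_order (\<lambda>y. measure_pmf.prob p {k. y < real k}) (\<lambda>y. y powr (- \<beta>))"
    and x: "0 < x" and a: "max (ln m - x\<^sup>2 / 2) 0 < a" and \<rho>: "\<rho> < ln m - x\<^sup>2 / 2"
  obtains C where "0 < C"
    "\<forall>\<^sub>F n in sequentially. C * exp ((\<rho> - \<beta> * a) * real n)
        \<le> \<P>(\<omega> in M. exp (a * real n) \<le> real (Z N X n \<omega> {x * real n..}))"
proof -
  have a0: "0 < a" and am: "ln m - x\<^sup>2 / 2 < a" using a by auto
  from exists_block_with_growth_rate[OF x m truncated_mean_tendsto[OF int, folded m_def] \<rho>]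
  obtain y B l where y: "x < y" and l: "0 < l" and B: "0 < truncated_mean p B"
    and \<mu>_ge: "exp (\<rho> * real l) \<le> truncated_mean p B ^ l * normal_tail (y * sqrt (real l))" .
  define \<mu> where "\<mu> = truncated_mean p B ^ l * normal_tail (y * real l / sqrt (real l))"
  have sqrt_l: "y * real l / sqrt (real l) = y * sqrt (real l)" by (metis of_nat_0_le_iff real_div_sqrt times_divide_eq_right)
  have \<mu>_ge: "exp (\<rho> * real l) \<le> \<mu>" using \<mu>_ge by (simp add: \<mu>_def sqrt_l)
  then have \<mu>_pos: "0 < \<mu>" by (rule less_le_trans[OF exp_gt_zero])
  have \<mu>_le: "\<mu> \<le> exp (a * real l)"
  proof -
    have "\<mu> \<le> m ^ l * exp (- (y * sqrt (real l))\<^sup>2 / 2)"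
      unfolding \<mu>_def sqrt_l m_def using B x y
      by (intro mult_mono power_mono truncated_mean_le int normal_tail_le) (auto simp: normal_tail_def)
    also have "\<dots> = exp (real l * (ln m - y\<^sup>2 / 2))"
    proof -
      have "real l * (ln m - y\<^sup>2 / 2) = real l * ln m + - (y * sqrt (real l))\<^sup>2 / 2"
        by (simp add: power_mult_distrib right_diff_distrib)
      moreover have "exp (real l * ln m) = m ^ l" using m by (simp add: exp_of_nat_mult)
      ultimately show ?thesis by (simp only: exp_add)
    qed
    also have "\<dots> \<le> exp (a * real l)"
    proof -
      have "x\<^sup>2 \<le> y\<^sup>2" using x y by (intro power_mono) auto
      then have "ln m - y\<^sup>2 / 2 \<le> a" using am by linarith
      then have "real l * (ln m - y\<^sup>2 / 2) \<le> real l * a" by (intro mult_left_mono) auto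
      then show ?thesis by (simp only: exp_le_cancel_iff mult.commute[of a])
    qed
    finally show ?thesis .
  qed
  define q where "q = normal_tail 0"
  have q: "0 < q" unfolding q_def by (rule normal_tail_pos) simp
  \<comment> \<open>So large that q K / 2, half of the expected number of children that do not move to the left, reaches exp (a n).\<close>
  define K where "K n = nat \<lceil>2 * exp (a * real n) / q\<rceil>" for n
  have K_ge: "2 / q * exp (a * real n) \<le> real (K n)" for n
    unfolding K_def using real_nat_ceiling_ge[of "2 * exp (a * real n) / q"] by simp
  have K_le: "real (K n) \<le> (2 / q + 1) * exp (a * real n)" for n
  proof -
    have "0 \<le> 2 * exp (a * real n) / q" using q by simp
    then have "real (K n) \<le> 2 * exp (a * real n) / q + 1" unfolding K_def by linarith
    also have "\<dots> \<le> 2 * exp (a * real n) / q + exp (a * real n)" using a0 by simp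
    finally show ?thesis by (simp add: algebra_simps)
  qed
  have K_pos: "0 < K n" for n
  proof -
    have "0 < 2 / q * exp (a * real n)" using q by simp
    then show ?thesis using K_ge[of n] by linarith
  qed
  define Q where "Q n = measure_pmf.prob p {K n<..}" for n
  have Q_eq: "measure_pmf.prob p {k. real (K n) < real k} = Q n" for n
    by (simp add: Q_def greaterThan_def)
  obtain c1 c2 where c1: "0 < c1" and
    c12: "\<forall>\<^sub>F y in at_top. c1 * y powr (- \<beta>) \<le> measure_pmf.prob p {k. y < real k}
        \<and> measure_pmf.prob p {k. y < real k} \<le> c2 * y powr (- \<beta>)"
    using same_order_powrE[OF tail] by blast
  have "filterlim (\<lambda>n. 2 / q * exp (a * real n)) at_top sequentially"
    using a0 q by real_asymp
  then have "filterlim (\<lambda>n. real (K n)) at_top sequentially"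
    by (rule filterlim_at_top_mono) (intro always_eventually allI K_ge)
  from eventually_compose_filterlim[OF c12 this]
  have Q_bounds: "\<forall>\<^sub>F n in sequentially. c1 * real (K n) powr (- \<beta>) \<le> Q n \<and> Q n \<le> c2 * real (K n) powr (- \<beta>)"
    by (simp only: Q_eq)
  have exp_powr: "(c * exp (a * real n)) powr (- \<beta>) = c powr (- \<beta>) * exp (- \<beta> * a * real n)" if "0 < c" for c n
    using that by (simp add: powr_mult) (simp add: powr_def mult_ac)
  define C1 where "C1 = c1 * (2 / q + 1) powr (- \<beta>)"
  have q1: "0 < 2 / q + 1" using q by (intro add_pos_pos) auto
  then have "0 < (2 / q + 1) powr (- \<beta>)" by (subst powr_gt_zero) linarith
  then have C1: "0 < C1" unfolding C1_def using c1 by (rule mult_pos_pos[rotated])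
  define C2 where "C2 = \<bar>c2\<bar> * (2 / q) powr (- \<beta>)"
  have C2: "0 \<le> C2" by (simp add: C2_def)
  have Q_ge: "\<forall>\<^sub>F n in sequentially. C1 * exp (- \<beta> * a * real n) \<le> Q n"
    using Q_bounds
  proof eventually_elim
    case (elim n)
    have "((2 / q + 1) * exp (a * real n)) powr (- \<beta>) \<le> real (K n) powr (- \<beta>)"
      using K_le[of n] K_pos[of n] \<beta> by (intro powr_mono2') auto
    then have "c1 * ((2 / q + 1) * exp (a * real n)) powr (- \<beta>) \<le> c1 * real (K n) powr (- \<beta>)"
      using c1 by (intro mult_left_mono) auto
    then show ?case using elim q1 unfolding C1_def by (simp only: exp_powr mult.assoc) linarith
  qed
  have Q_le: "\<forall>\<^sub>F n in sequentially. Q n \<le> C2 * exp (- \<beta> * a * real n)"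
    using Q_bounds
  proof eventually_elim
    case (elim n)
    have "0 < 2 / q" using q by simp
    then have "real (K n) powr (- \<beta>) \<le> (2 / q * exp (a * real n)) powr (- \<beta>)"
      using K_ge[of n] \<beta> by (intro powr_mono2') auto
    then have "\<bar>c2\<bar> * real (K n) powr (- \<beta>) \<le> \<bar>c2\<bar> * (2 / q * exp (a * real n)) powr (- \<beta>)"
      by (intro mult_left_mono) auto
    moreover have "c2 * real (K n) powr (- \<beta>) \<le> \<bar>c2\<bar> * real (K n) powr (- \<beta>)"
      by (intro mult_right_mono) auto
    ultimately show ?case using elim \<open>0 < 2 / q\<close> unfolding C2_def by (simp only: exp_powr mult.assoc) linarith
  qed
  define D where "D = real ((B ^ l)\<^sup>2) / \<mu>"
  have D: "0 \<le> D" using \<mu>_pos by (simp add: D_def)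
  \<comment> \<open>The quadratic correction is negligible: the geometric sum is at most n exp (a n), whereas Q is of
    order exp (- \<beta> a n) with \<beta> > 1.\<close>
  have "\<forall>\<^sub>F n in sequentially. D * C2 * exp (- \<beta> * a * real n) * (real n * exp (a * real n)) \<le> q / 4"
  proof -
    have "(\<lambda>n. D * C2 * (real n * exp (- ((\<beta> - 1) * a) * real n))) \<longlonglongrightarrow> D * C2 * 0"
    proof (rule tendsto_mult_left)
      have "(\<lambda>n. real n * exp (- d * real n)) \<longlonglongrightarrow> 0" if "0 < d" for d :: real
        using that by real_asymp
      then show "(\<lambda>n. real n * exp (- ((\<beta> - 1) * a) * real n)) \<longlonglongrightarrow> 0"
        using \<beta> a0 by simp
    qed
    then have "\<forall>\<^sub>F n in sequentially. D * C2 * (real n * exp (- ((\<beta> - 1) * a) * real n)) < q / 4"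
      using q by (intro order_tendstoD) auto
    then show ?thesis
    proof eventually_elim
      case (elim n)
      have "exp (- ((\<beta> - 1) * a) * real n) = exp (- \<beta> * a * real n) * exp (a * real n)"
        unfolding exp_add[symmetric] by (simp add: algebra_simps)
      with elim show ?case by (simp add: mult_ac)
    qed
  qed
  moreover have "\<forall>\<^sub>F n in sequentially. x * real n \<le> y * (real n - 1 - real l)"
    using x y by real_asymp
  moreover have "\<forall>\<^sub>F n in sequentially. 2 \<le> n" by (rule eventually_ge_at_top)
  ultimately have "\<forall>\<^sub>F n in sequentially.
      q * (q / 4) * exp (- \<bar>\<rho>\<bar> * (real l + 1)) * C1 * exp ((\<rho> - \<beta> * a) * real n)
        \<le> \<P>(\<omega> in M. exp (a * real n) \<le> real (Z N X n \<omega> {x * real n..}))"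
    using Q_ge Q_le
  proof eventually_elim
    case (elim n)
    \<comment> \<open>With n - 1 = k l + r and 1 \<le> r \<le> l the initial run has at least one step, as required by the
      normal law of a displacement.\<close>
    define k where "k = (n - 2) div l"
    define r where "r = (n - 2) mod l + 1"
    have r: "0 < r" "r \<le> l" using l by (auto simp: r_def Suc_le_eq)
    have n: "n = 1 + k * l + r"
      using elim(3) div_mult_mod_eq[of "n - 2" l] unfolding k_def r_def by linarith
    have kl: "real k * real l = real n - 1 - real r"
      using arg_cong[OF n, of real] by simp
    \<comment> \<open>Since y > x, the k blocks alone reach the level x n although the other generations contribute nothing.\<close>
    have "x * real n \<le> y * (real n - 1 - real l)" by (rule elim(2))
    also have "\<dots> \<le> y * (real k * real l)"
      unfolding kl using r x y by (intro mult_left_mono) auto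
    finally have t: "x * real n \<le> real k * (y * real l)" by (simp add: mult_ac)
    have c: "exp (a * real n) \<le> q * real (K n) / 2" using K_ge[of n] q by (simp add: field_simps)
    let ?S = "\<Sum>j<k. \<mu> ^ j"
    note bound = prob_Z_ge_ge[OF p0 l K_pos r(1) n, where B = B and s = "y * real l" and t = "x * real n"
        and c = "exp (a * real n)", folded \<mu>_def q_def Q_def, OF \<mu>_pos c t, folded D_def]
    have "?S \<le> (\<Sum>j<k. exp (a * real n))"
    proof (rule sum_mono)
      fix j assume "j \<in> {..<k}"
      then have "real j * real l \<le> real k * real l" by (intro mult_right_mono) auto
      then have jl: "a * (real j * real l) \<le> a * real n"
        unfolding kl using a0 r by (intro mult_left_mono) auto
      have "\<mu> ^ j \<le> exp (a * real l) ^ j" using \<mu>_le \<mu>_pos by (intro power_mono) auto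
      also have "\<dots> = exp (a * (real j * real l))" by (simp add: exp_of_nat_mult[symmetric] mult_ac)
      also have "\<dots> \<le> exp (a * real n)" using jl by simp
      finally show "\<mu> ^ j \<le> exp (a * real n)" .
    qed
    also have "\<dots> \<le> real n * exp (a * real n)"
    proof -
      have "k \<le> k * l" using l by simp
      then have "k \<le> n" using n by linarith
      then show ?thesis by simp
    qed
    finally have S_le: "?S \<le> real n * exp (a * real n)" .
    have S_nonneg: "0 \<le> ?S" using \<mu>_pos by (intro sum_nonneg) auto
    have Q_nonneg: "0 \<le> Q n" by (simp add: Q_def)
    have "D * Q n * ?S \<le> D * (C2 * exp (- \<beta> * a * real n)) * (real n * exp (a * real n))"
      using elim S_le D C2 S_nonneg Q_nonneg by (intro mult_mono mult_nonneg_nonneg) auto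
    also have "\<dots> \<le> q / 4" using elim(1) by (simp add: mult_ac)
    finally have "D * Q n * ?S \<le> q / 4" .
    from mult_right_mono[OF this Q_nonneg]
    have DQ: "D * (Q n)\<^sup>2 * ?S \<le> q / 4 * Q n" by (simp add: power2_eq_square mult_ac)
    have "exp (- \<bar>\<rho>\<bar> * (real l + 1)) * exp (\<rho> * real n) \<le> exp (\<rho> * (real k * real l))"
    proof -
      have "\<rho> * (1 + real r) \<le> \<bar>\<rho>\<bar> * (1 + real r)" by (intro mult_right_mono) auto
      also have "\<dots> \<le> \<bar>\<rho>\<bar> * (real l + 1)" using r by (intro mult_left_mono) auto
      finally show ?thesis unfolding kl exp_add[symmetric] by (simp add: algebra_simps)
    qed
    also have "\<dots> = exp (\<rho> * real l) ^ k" by (simp add: exp_of_nat_mult[symmetric] mult_ac)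
    also have "\<dots> \<le> \<mu> ^ k" using \<mu>_ge by (intro power_mono) auto
    finally have \<mu>k: "exp (- \<bar>\<rho>\<bar> * (real l + 1)) * exp (\<rho> * real n) \<le> \<mu> ^ k" .
    have split: "exp ((\<rho> - \<beta> * a) * real n) = exp (\<rho> * real n) * exp (- \<beta> * a * real n)"
      unfolding exp_add[symmetric] by (simp add: algebra_simps)
    have "q * (q / 4) * exp (- \<bar>\<rho>\<bar> * (real l + 1)) * C1 * exp ((\<rho> - \<beta> * a) * real n)
        = q * ((exp (- \<bar>\<rho>\<bar> * (real l + 1)) * exp (\<rho> * real n)) * (q / 4 * (C1 * exp (- \<beta> * a * real n))))"
      unfolding split by (simp add: mult_ac)
    also have "\<dots> \<le> q * (\<mu> ^ k * (q / 4 * Q n))"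
      using \<mu>k elim(4) q C1 \<mu>_pos by (intro mult_left_mono mult_mono mult_nonneg_nonneg) auto
    also have "\<dots> \<le> q * (\<mu> ^ k * (q / 2 * Q n - D * (Q n)\<^sup>2 * ?S))"
      using DQ q \<mu>_pos by (intro mult_left_mono) (auto simp: algebra_simps)
    also note bound
    finally show ?case .
  qed
  moreover have "0 < q * (q / 4) * exp (- \<bar>\<rho>\<bar> * (real l + 1)) * C1" using q C1 by simp
  ultimately show thesis using that by blast
qed

end

theorem theorem1p4:
  fixes M :: "'w measure" and p :: "nat pmf"
    and N :: "nat list \<Rightarrow> 'w \<Rightarrow> nat" and X :: "nat list \<Rightarrow> 'w \<Rightarrow> real"
    and m \<beta> x a :: real
  assumes "branching_random_walk M p std_normal_distribution N X"
    and "pmf p 0 = 0"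
    and "integrable M (\<lambda>\<omega>. real (Z N X 1 \<omega> UNIV))"
    and "m = mean_offspring M N X" and "1 < m"
    and "\<beta> > 1"
    and "same_order (\<lambda>y. measure M {\<omega> \<in> space M. real (Z N X 1 \<omega> UNIV) > y}) (\<lambda>y. y powr (- \<beta>))"
    and "x > 0"
    and "a > max (ln m - x\<^sup>2 / 2) 0"
  shows "let r = (\<lambda>n. elog (measure M {\<omega> \<in> space M. real (Z N X n \<omega> {x * real n..}) \<ge> exp (a * real n)})
                       / ereal (real n))
         in ereal (- ((\<beta> - 1) * a + a - (ln m - x\<^sup>2 / 2))) \<le> liminf r
            \<and> liminf r \<le> limsup r
            \<and> limsup r \<le> ereal (- (a - (ln m - x\<^sup>2 / 2)))"
proof -
  interpret gaussian_brw M p N X unfolding gaussian_brw_def by (rule assms(1))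
  have int: "integrable (measure_pmf p) real" using assms(3) integrable_offspring_iff by simp
  have m: "m = measure_pmf.expectation p real" using assms(4) by (simp add: mean_offspring_eq_expectation)
  have m0: "0 < m" using \<open>1 < m\<close> by simp
  have tail: "same_order (\<lambda>y. measure_pmf.prob p {k. y < real k}) (\<lambda>y. y powr (- \<beta>))"
  proof -
    have "\<P>(\<omega> in M. y < real (N [] \<omega>)) = measure_pmf.prob p {k. y < real k}" for y
      by (rule prob_N)
    then show ?thesis using assms(7) unfolding Z_1_UNIV by (simp only:)
  qed
  define r where "r = (\<lambda>n. elog (measure M {\<omega> \<in> space M. real (Z N X n \<omega> {x * real n..}) \<ge> exp (a * real n)})
                       / ereal (real n))"
  have "limsup r \<le> ereal (- (a - (ln m - x\<^sup>2 / 2)))"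
  proof (rule Limsup_bounded)
    show "\<forall>\<^sub>F n in sequentially. r n \<le> ereal (- (a - (ln m - x\<^sup>2 / 2)))"
      using eventually_gt_at_top[of 0]
    proof eventually_elim
      case (elim n)
      show ?case unfolding r_def m
        using prob_Z_ge_upper_bound[OF int m0[unfolded m] less_imp_le[OF \<open>x > 0\<close>] elim, of a]
        by (intro elog_div_le elim)
    qed
  qed
  moreover have "liminf r \<le> limsup r" by (rule Liminf_le_Limsup) simp
  moreover have "ereal (- ((\<beta> - 1) * a + a - (ln m - x\<^sup>2 / 2))) \<le> liminf r"
  proof (rule ereal_le_epsilon2)
    fix e :: real assume e: "0 < e"
    let ?\<rho> = "ln m - x\<^sup>2 / 2 - e"
    obtain C where C: "0 < C" "\<forall>\<^sub>F n in sequentially. C * exp ((?\<rho> - \<beta> * a) * real n)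
        \<le> \<P>(\<omega> in M. exp (a * real n) \<le> real (Z N X n \<omega> {x * real n..}))"
      using prob_Z_ge_lower_bound[OF assms(2) int m m0 \<open>\<beta> > 1\<close> tail \<open>x > 0\<close> assms(9), of ?\<rho>] e by auto
    have "(\<lambda>n. ereal (?\<rho> - \<beta> * a + ln C / real n)) \<longlonglongrightarrow> ereal (?\<rho> - \<beta> * a)"
    proof -
      have "(\<lambda>n. ?\<rho> - \<beta> * a + ln C / real n) \<longlonglongrightarrow> ?\<rho> - \<beta> * a + 0"
        by (intro tendsto_add tendsto_const lim_const_over_n)
      then show ?thesis by simp
    qed
    then have "ereal (?\<rho> - \<beta> * a) = liminf (\<lambda>n. ereal (?\<rho> - \<beta> * a + ln C / real n))"
      by (intro lim_imp_Liminf[symmetric]) auto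
    also have "\<dots> \<le> liminf r"
    proof (rule Liminf_mono)
      show "\<forall>\<^sub>F n in sequentially. ereal (?\<rho> - \<beta> * a + ln C / real n) \<le> r n"
        using C(2) eventually_gt_at_top[of 0]
      proof eventually_elim
        case (elim n)
        show ?case unfolding r_def by (intro elog_div_ge elim C(1))
      qed
    qed
    finally have "ereal (?\<rho> - \<beta> * a) + ereal e \<le> liminf r + ereal e" by (rule add_right_mono)
    moreover have "?\<rho> - \<beta> * a + e = - ((\<beta> - 1) * a + a - (ln m - x\<^sup>2 / 2))"
      by (simp add: algebra_simps)
    ultimately show "ereal (- ((\<beta> - 1) * a + a - (ln m - x\<^sup>2 / 2))) \<le> liminf r + ereal e"
      by (simp only: plus_ereal.simps)
  qed
  ultimately show ?thesis unfolding Let_def r_def by blast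
qed

end
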